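(* Let $d\in\mathbb{N}$, $d\geq 2$, and let $(F_n)_{n\in\mathbb{N}}$ be ballistic aggregation in $\mathbb{Z}^d$. There exists a constant $c>0$ such that almost surely, for all $n$ sufficiently large, $$\mathrm{rad}(F_n)\leq c\, n^{1/2}.$$
   Context: Here $\mathbb{N}=\{1,2,\ldots\}$ and $\|\cdot\|$ is the Euclidean norm. Two points $x,y\in\mathbb{Z}^d$ are neighbours if $\|x-y\|=1$. For a finite $A\subset\mathbb{Z}^d$, the outer boundary is $\partial A=\{y\in\mathbb{Z}^d\setminus A:\ y \text{ has a neighbour in } A\}$, and $\mathrm{rad}(A)=\max_{x\in A}\|x\|$. Incremental aggregation: let $\mathcal{M}=(\mu_A)$ be a family of probability measures indexed by the nonempty finite sets $A\subset\mathbb{Z}^d$, with $\mu_A$ a probability measure on $A$. A sequence $(F_n)_{n\in\mathbb{N}}$ of random finite subsets of $\mathbb{Z}^d$ on a probability space is called incremental aggregation with distribution family $\mathcal{M}$ if $F_1=\{y_1\}$ with $y_1=0$ and, for each $n\in\mathbb{N}$, $F_{n+1}=F_n\cup\{y_{n+1}\}$, where $y_{n+1}$ is a random point of $\mathbb{Z}^d$ whose conditional distribution given $F_1,\ldots,F_n$ depends only on $F_n$ and equals $\mu_{\partial F_n}$, i.e. $\mathbb{P}(y_{n+1}=y\mid F_n=A)=\mu_{\partial A}(y)$. In particular $(F_n)$ is a Markov chain. Ballistic measure: let $A(d,1)$ be the space of (affine) lines in $\mathbb{R}^d$ with its usual Borel $\sigma$-algebra; for compact $K\subset\mathbb{R}^d$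 let $[K]=\{L\in A(d,1): L\cap K\neq\emptyset\}$. Let $\mu_1$ be the unique Radon measure on $A(d,1)$ invariant under Euclidean motions with $\mu_1([B_d])=\kappa_{d-1}$, where $B_d$ is the closed unit ball of $\mathbb{R}^d$ and $\kappa_{d-1}$ is the volume of the unit ball in $\mathbb{R}^{d-1}$. For compact $K$ with $\mu_1([K])>0$ define the probability measure $\mathbb{P}^K(\cdot)=\mu_1(\cdot\cap[K])/\mu_1([K])$ on $A(d,1)$. For $z\in\mathbb{Z}^d$ let $C_z=z+[-\tfrac12,\tfrac12]^d$ and for finite $A\subset\mathbb{Z}^d$ let $\square A=\bigcup_{z\in A}C_z$. For each line $L$ fix a direction $v_L\in\mathbb{S}^{d-1}$ of $L$ (measurably in $L$). For a nonempty finite $A\subset\mathbb{Z}^d$ let $L^A=\{z\in A: C_z\cap L\neq\emptyset\}$; traversing $L$ in direction $v_L$ orders $L^A$ according to the order in which the boxes $C_z$ are visited (this is well defined for $\mu_1$-almost every $L$; ties for the exceptional lines are broken lexicographically), and $\min(L^A)$, $\max(L^A)$ denote the first and last point of $L^A$ in this order. Set $b_A(z,L)=1$ if $L^A=\{z\}$; $b_A(z,L)=\tfrac12$ if $\#(L^A)>1$ and $z\in\{\min(L^A),\max(L^A)\}$; and $b_A(z,L)=0$ otherwise. The ballistic measure on $A$ is $b_A(z)=\int_{A(d,1)}b_A(z,L)\,\mathbb{P}^{\square A}(dL)$, $z\in\mathbb{Z}^d$; it is a probability measure concentrated on $A$. Ballistic aggregation in $\mathbb{Z}^d$ is incremental aggregation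 with distribution family $(b_A)$. *)

theory Defs
  imports "HOL-Probability.Probability"
begin

text \<open>Points of the integer lattice are vectors of type \<^typ>\<open>int^'n\<close>, where the dimension is
  the number of elements of the index type.\<close>

definition real_vec :: "int^'n \<Rightarrow> real^'n" where
  "real_vec z = (\<chi> i. real_of_int (z $ i))"

definition neighbours :: "int^'n \<Rightarrow> int^'n \<Rightarrow> bool" where
  "neighbours x y \<longleftrightarrow> norm (real_vec x - real_vec y) = 1"

definition outer_boundary :: "(int^'n) set \<Rightarrow> (int^'n) set" where
  "outer_boundary A = {y. y \<notin> A \<and> (\<exists>x\<in>A. neighbours y x)}"

definition rad :: "(int^'n) set \<Rightarrow> real" where
  "rad A = Max ((\<lambda>x. norm (real_vec x)) ` A)"

text \<open>A distribution family is given by its point masses: \<open>\<mu> A z\<close> is the mass that the probability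
  measure belonging to the nonempty finite set \<open>A\<close> gives to the point \<open>z\<close>. Time starts at 1; the
  values at index 0 are irrelevant. As all \<open>F k\<close> take values in a countable set, conditioning on
  \<open>F 1, \<dots>, F n\<close> amounts to conditioning on the possible histories of positive probability.\<close>

definition incremental_aggregation ::
  "((int^'n) set \<Rightarrow> int^'n \<Rightarrow> real) \<Rightarrow> 'w measure \<Rightarrow> (nat \<Rightarrow> 'w \<Rightarrow> (int^'n) set) \<Rightarrow> bool" where
  "incremental_aggregation \<mu> M F \<longleftrightarrow>
     prob_space M \<and>
     (\<forall>n\<ge>1. F n \<in> measurable M (count_space {A. finite A})) \<and>
     (\<exists>y. (\<forall>n\<ge>1. y n \<in> measurable M (count_space UNIV)) \<and>
          (\<forall>\<omega>\<in>space M. y 1 \<omega> = 0 \<and> F 1 \<omega> = {y 1 \<omega>}) \<and>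
          (\<forall>n\<ge>1. \<forall>\<omega>\<in>space M. F (n + 1) \<omega> = F n \<omega> \<union> {y (n + 1) \<omega>}) \<and>
          (\<forall>n\<ge>1. \<forall>A z. \<P>(\<omega> in M. \<forall>k\<in>{1..n}. F k \<omega> = A k) > 0 \<longrightarrow>
             \<P>(\<omega> in M. y (n + 1) \<omega> = z \<bar> \<forall>k\<in>{1..n}. F k \<omega> = A k)
               = \<mu> (outer_boundary (A n)) z))"

definition lines :: "(real^'n) set set" where
  "lines = {L. affine L \<and> aff_dim L = 1}"

definition line_through :: "real^'n \<Rightarrow> real^'n \<Rightarrow> (real^'n) set" where
  "line_through x u = range (\<lambda>t. x + t *\<^sub>R u)"

text \<open>The usual topology on the space of lines: the finest one for which the line depends
  continuously on a point and a unit direction.\<close>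

definition line_topology :: "(real^'n) set topology" where
  "line_topology = topology (\<lambda>U. U \<subseteq> lines \<and>
     openin (top_of_set (UNIV \<times> sphere 0 1))
       {(x, u) \<in> UNIV \<times> sphere 0 1. line_through x u \<in> U})"

lemma openin_line_topology:
  "openin line_topology U \<longleftrightarrow> U \<subseteq> lines \<and>
     openin (top_of_set (UNIV \<times> sphere 0 1))
       {(x, u) \<in> UNIV \<times> sphere 0 1. line_through x u \<in> U}"
proof -
  let ?S = "UNIV \<times> sphere 0 1 :: ((real^'n) \<times> (real^'n)) set"
  let ?T = "top_of_set ?S"
  let ?pre = "\<lambda>U. {(x, u) \<in> ?S. line_through x u \<in> U}"
  have "istopology (\<lambda>U. U \<subseteq> lines \<and> openin ?T (?pre U))"
    unfolding istopology_def
  proof (intro conjI allI impI)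
    fix U V :: "(real^'n) set set"
    assume U: "U \<subseteq> lines \<and> openin ?T (?pre U)" and V: "V \<subseteq> lines \<and> openin ?T (?pre V)"
    have "?pre (U \<inter> V) = ?pre U \<inter> ?pre V" by auto
    moreover have "openin ?T (?pre U \<inter> ?pre V)"
      by (rule openin_Int[OF conjunct2[OF U] conjunct2[OF V]])
    ultimately show "openin ?T (?pre (U \<inter> V))" by (rule ssubst)
    show "U \<inter> V \<subseteq> lines" using U by auto
  next
    fix K :: "(real^'n) set set set"
    assume K: "\<forall>U\<in>K. U \<subseteq> lines \<and> openin ?T (?pre U)"
    have "?pre (\<Union>K) = \<Union>(?pre ` K)" by auto
    moreover have "openin ?T (\<Union>(?pre ` K))"
    proof (rule openin_Union)
      fix W assume "W \<in> ?pre ` K"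
      then obtain U where U: "U \<in> K" and W: "W = ?pre U" by (rule imageE)
      show "openin ?T W" unfolding W by (rule conjunct2[OF bspec[OF K U]])
    qed
    ultimately show "openin ?T (?pre (\<Union>K))" by (rule ssubst)
    show "\<Union>K \<subseteq> lines" using K by auto
  qed
  then have "openin line_topology = (\<lambda>U. U \<subseteq> lines \<and> openin ?T (?pre U))"
    unfolding line_topology_def by (rule topology_inverse')
  then show ?thesis by (rule fun_cong)
qed

definition line_borel :: "(real^'n) set measure" where
  "line_borel = sigma lines {U. openin line_topology U}"

text \<open>The lines hitting \<open>K\<close>, written \<open>[K]\<close> in the literature.\<close>

definition hitting_lines :: "(real^'n) set \<Rightarrow> (real^'n) set set" where
  "hitting_lines K = {L \<in> lines. L \<inter> K \<noteq> {}}"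

definition euclidean_motion :: "(real^'n \<Rightarrow> real^'n) \<Rightarrow> bool" where
  "euclidean_motion g \<longleftrightarrow> (\<exists>a f. orthogonal_transformation f \<and> g = (\<lambda>x. a + f x))"

text \<open>The space of lines is locally compact and Hausdorff with a countable base, so a Radon measure
  is the same as a Borel measure that is finite on compact sets: regularity is automatic.
  The measure is characterized here by the properties that determine it uniquely.\<close>

definition invariant_line_measure :: "(real^'n) set measure \<Rightarrow> bool" where
  "invariant_line_measure \<mu>\<^sub>1 \<longleftrightarrow>
     sets \<mu>\<^sub>1 = sets line_borel \<and>
     (\<forall>C. compactin line_topology C \<longrightarrow> emeasure \<mu>\<^sub>1 C < \<infinity>) \<and>
     (\<forall>g. euclidean_motion g \<longrightarrow>
        (\<forall>B\<in>sets \<mu>\<^sub>1. emeasure \<mu>\<^sub>1 ((\<lambda>L. g ` L) ` B) = emeasure \<mu>\<^sub>1 B)) \<and>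
     emeasure \<mu>\<^sub>1 (hitting_lines (cball 0 1)) = ennreal (unit_ball_vol (real (CARD('n) - 1)))"

definition line_direction :: "((real^'n) set \<Rightarrow> real^'n) \<Rightarrow> bool" where
  "line_direction v \<longleftrightarrow>
     v \<in> measurable line_borel borel \<and>
     (\<forall>L\<in>lines. norm (v L) = 1 \<and> (\<forall>x\<in>L. x + v L \<in> L))"

definition box_at :: "int^'n \<Rightarrow> (real^'n) set" where
  "box_at z = (\<lambda>x. real_vec z + x) ` cbox (\<chi> i. - 1/2) (\<chi> i. 1/2)"

definition boxes :: "(int^'n) set \<Rightarrow> (real^'n) set" where
  "boxes A = (\<Union>z\<in>A. box_at z)"

definition visited :: "(int^'n) set \<Rightarrow> (real^'n) set \<Rightarrow> (int^'n) set" where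
  "visited A L = {z \<in> A. box_at z \<inter> L \<noteq> {}}"

definition entry_time :: "((real^'n) set \<Rightarrow> real^'n) \<Rightarrow> (real^'n) set \<Rightarrow> int^'n \<Rightarrow> real" where
  "entry_time v L z = Inf ((\<lambda>x. x \<bullet> v L) ` (box_at z \<inter> L))"

definition lex_less :: "int^'n::{finite,linorder} \<Rightarrow> int^'n::_ \<Rightarrow> bool" where
  "lex_less z w \<longleftrightarrow> (\<exists>i. z $ i < w $ i \<and> (\<forall>j<i. z $ j = w $ j))"

text \<open>Boxes are ordered by the time at which the line, traversed in its direction, enters them.
  Two boxes hit by a line are entered simultaneously only for a null set of lines.\<close>

definition visited_no_later ::
  "((real^'n::{finite,linorder}) set \<Rightarrow> real^'n::_) \<Rightarrow> (real^'n::_) set \<Rightarrow> int^'n::_ \<Rightarrow> int^'n::_ \<Rightarrow> bool" where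
  "visited_no_later v L z w \<longleftrightarrow>
     entry_time v L z < entry_time v L w \<or>
     (entry_time v L z = entry_time v L w \<and> (z = w \<or> lex_less z w))"

definition is_first_visited ::
  "((real^'n::{finite,linorder}) set \<Rightarrow> real^'n::_) \<Rightarrow> (int^'n::_) set \<Rightarrow> (real^'n::_) set \<Rightarrow> int^'n::_ \<Rightarrow> bool" where
  "is_first_visited v A L z \<longleftrightarrow>
     z \<in> visited A L \<and> (\<forall>w\<in>visited A L. visited_no_later v L z w)"

definition is_last_visited ::
  "((real^'n::{finite,linorder}) set \<Rightarrow> real^'n::_) \<Rightarrow> (int^'n::_) set \<Rightarrow> (real^'n::_) set \<Rightarrow> int^'n::_ \<Rightarrow> bool" where
  "is_last_visited v A L z \<longleftrightarrow>
     z \<in> visited A L \<and> (\<forall>w\<in>visited A L. visited_no_later v L w z)"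

definition ballistic_weight ::
  "((real^'n::{finite,linorder}) set \<Rightarrow> real^'n::_) \<Rightarrow> (int^'n::_) set \<Rightarrow> int^'n::_ \<Rightarrow> (real^'n::_) set \<Rightarrow> real" where
  "ballistic_weight v A z L =
     (if visited A L = {z} then 1
      else if card (visited A L) > 1 \<and> (is_first_visited v A L z \<or> is_last_visited v A L z) then 1/2
      else 0)"

text \<open>\<^const>\<open>uniform_measure\<close> conditions the line measure on hitting the union of the boxes.\<close>

definition ballistic_measure ::
  "(real^'n::{finite,linorder}) set measure \<Rightarrow> ((real^'n::_) set \<Rightarrow> real^'n::_) \<Rightarrow>
   (int^'n::_) set \<Rightarrow> int^'n::_ \<Rightarrow> real" where
  "ballistic_measure \<mu>\<^sub>1 v A z =
     (LINT L | uniform_measure \<mu>\<^sub>1 (hitting_lines (boxes A)). ballistic_weight v A z L)"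

definition ballistic_aggregation ::
  "(real^'n::{finite,linorder}) set measure \<Rightarrow> ((real^'n::_) set \<Rightarrow> real^'n::_) \<Rightarrow>
   'w measure \<Rightarrow> (nat \<Rightarrow> 'w \<Rightarrow> (int^'n::_) set) \<Rightarrow> bool" where
  "ballistic_aggregation \<mu>\<^sub>1 v M F \<longleftrightarrow> incremental_aggregation (ballistic_measure \<mu>\<^sub>1 v) M F"

end

theory Submission
  imports Defs "HOL-Real_Asymp.Real_Asymp"
begin

text \<open>The argument follows Kesten's method for DLA. Since boxes are bounded, a site of the boundary of
  a cluster \<open>A\<close> with a point \<open>x\<close> receives ballistic mass \<open>O(1) / \<mu>\<^sub>1 [\<box>(\<partial>A)]\<close>, and the denominator is at least of
  order \<open>norm x\<close>. Only invariance of \<open>\<mu>\<^sub>1\<close> is used for this, not its explicit form. In dimension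
  at least three, balls of radius \<open>1/2\<close> at distance \<open>r\<close> are hit jointly with measure \<open>O(r\<^sup>-\<^sup>2)\<close>, which is summable
  along boundary sites chosen on equally spaced levels, so Bonferroni's inequality applies. In the plane
  this fails by a logarithm, but there every line crossing the segment from \<open>0\<close> to \<open>x\<close>
  has to cross the boundary of \<open>A\<close>.

  For the growth, let \<open>\<Phi>(A)\<close> be the sum of \<open>exp (norm x - \<rho>)\<close> over the points \<open>x \<in> A\<close> with \<open>norm x \<ge> \<rho>\<close>.
  A new point is a neighbour of an old one and each site has mass \<open>O(1/\<rho>)\<close>, so the expectation of \<open>\<Phi>\<close>
  grows at most by a factor \<open>1 + O(1/\<rho>)\<close> and an additive constant in each step. As radius \<open>2\<rho>\<close> forces
  \<open>\<Phi> \<ge> exp \<rho>\<close>, Markov's inequality at time \<open>\<epsilon>\<rho>\<^sup>2\<close> and the Borel-Cantelli lemma conclude.\<close>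

section \<open>Lines and Euclidean motions\<close>

text \<open>The exponent 1/2 comes from one balance: after n steps the potential has mean at most e
  n exp (D n / rho), while radius 2 rho forces it above exp rho, so n must be of order rho squared.
  Kesten's argument sums over chains of attachment sites; the exponential potential turns this into
  a linear recursion, because the weights of neighbours differ by a factor of at most e and the
  expected growth is thus proportional to the potential itself. The size of the cluster enters
  without a stopping time: a candidate site of norm at least rho + 1 touches an old point of norm at
  least rho, and that point alone gives the bound C / rho for its mass. The split by dimension comes
  from a packing count. On a sphere of radius r about one ball there is room for order r squared
  further balls whose joint hitting events with it are disjoint, once three coordinates are
  available. In the plane there is room for order r only, the overlaps are of order 1 / r, and their
  sum along a row of balls is harmonic.\<close>

lemma line_through_eq_affine_hull: "line_through x u = affine hull {x, x + u}"
  by (simp add: line_through_def affine_hull_2_alt)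

lemma line_through_in_lines:
  assumes "u \<noteq> 0"
  shows "line_through x u \<in> lines"
  using assms by (simp add: lines_def line_through_eq_affine_hull)

lemma lines_obtain_direction:
  assumes "L \<in> lines" "p \<in> L"
  obtains u where "norm u = 1" "L = line_through p u"
proof -
  have L: "affine L" "aff_dim L = 1" using assms(1) by (auto simp: lines_def)
  have "L \<noteq> {p}" using L(2) by auto
  then obtain q where q: "q \<in> L" "q \<noteq> p" using assms(2) by blast
  let ?u = "(1 / norm (q - p)) *\<^sub>R (q - p)"
  have u: "norm ?u = 1" using q(2) by simp
  have sub: "line_through p ?u \<subseteq> L"
  proof
    fix y assume "y \<in> line_through p ?u"
    then obtain t where y: "y = p + t *\<^sub>R ?u" by (auto simp: line_through_def)
    have "y = (1 - t / norm (q - p)) *\<^sub>R p + (t / norm (q - p)) *\<^sub>R q"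
      by (simp add: y algebra_simps)
    then show "y \<in> L" using L(1) assms(2) q(1) by (simp add: mem_affine)
  qed
  have "?u \<noteq> 0" using q(2) by simp
  then have "line_through p ?u \<in> lines" by (rule line_through_in_lines)
  then have "line_through p ?u = L"
    using affine_dim_equal[of "line_through p ?u" L] sub L
    by (auto simp: lines_def line_through_def)
  then show thesis by (rule that[OF u, OF sym])
qed

lemma lines_nonempty: "L \<in> lines \<Longrightarrow> L \<noteq> {}"
  by (auto simp: lines_def)

lemma lines_obtain:
  assumes "L \<in> lines"
  obtains x u where "norm u = 1" "L = line_through x u"
  using lines_nonempty[OF assms] lines_obtain_direction[OF assms] by blast

lemma line_through_motion:
  assumes "orthogonal_transformation f"
  shows "(\<lambda>x. a + f x) ` line_through x u = line_through (a + f x) (f u)"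
proof -
  have l: "linear f" using assms by (simp add: orthogonal_transformation)
  show ?thesis
    by (simp add: line_through_def image_image linear_add[OF l] linear_cmul[OF l] add.assoc)
qed

lemma euclidean_motion_lines:
  assumes "euclidean_motion g" "L \<in> lines"
  shows "g ` L \<in> lines"
proof -
  obtain a f where f: "orthogonal_transformation f" "g = (\<lambda>x. a + f x)"
    using assms(1) by (auto simp: euclidean_motion_def)
  obtain x u where u: "norm u = 1" "L = line_through x u" using lines_obtain[OF assms(2)] .
  have "norm (f u) = 1" using f(1) u(1) by (simp add: orthogonal_transformation_norm)
  then have "f u \<noteq> 0" by auto
  then have "line_through (a + f x) (f u) \<in> lines" by (rule line_through_in_lines)
  then show ?thesis by (simp only: f(2) u(2) line_through_motion[OF f(1)])
qed

lemma euclidean_motion_inverse: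
  fixes g :: "real^'n \<Rightarrow> real^'n"
  assumes "euclidean_motion g"
  shows "bij g" "euclidean_motion (inv g)"
proof -
  obtain a f where f: "orthogonal_transformation f" and g: "g = (\<lambda>x. a + f x)"
    using assms by (auto simp: euclidean_motion_def)
  have b: "bij f" using f by (rule orthogonal_transformation_bij)
  have i: "orthogonal_transformation (inv f)" using f by (rule orthogonal_transformation_inv)
  then have l: "linear (inv f)" by (simp add: orthogonal_transformation)
  let ?h = "\<lambda>x. inv f (- a) + inv f x"
  have 1: "g (?h x) = x" for x
    using b by (simp add: g linear_add[OF l, symmetric] bij_is_surj surj_f_inv_f)
  have 2: "?h (g x) = x" for x
    using b by (simp add: g linear_add[OF l, symmetric] bij_is_inj)
  show "bij g" by (rule o_bij[of ?h]) (use 1 2 in auto)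
  have "inv g = ?h" by (rule inv_equality) (use 1 2 in auto)
  then show "euclidean_motion (inv g)" using i unfolding euclidean_motion_def
    by (intro exI[of _ "inv f (- a)"] exI[of _ "inv f"]) auto
qed

text \<open>Invariance of the measure is stated for images of sets of lines; this turns it into a
  statement about moving the compact set. The nontrivial inclusion pulls a line back along
  \<open>inv g\<close>, which is again a motion.\<close>

lemma hitting_lines_motion:
  fixes g :: "real^'n \<Rightarrow> real^'n"
  assumes "euclidean_motion g"
  shows "(`) g ` hitting_lines K = hitting_lines (g ` K)"
proof
  note b = euclidean_motion_inverse(1)[OF assms]
  show "(`) g ` hitting_lines K \<subseteq> hitting_lines (g ` K)"
    using euclidean_motion_lines[OF assms] by (auto simp: hitting_lines_def)
  show "hitting_lines (g ` K) \<subseteq> (`) g ` hitting_lines K"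
  proof
    fix L assume "L \<in> hitting_lines (g ` K)"
    then have L: "L \<in> lines" "L \<inter> g ` K \<noteq> {}" by (auto simp: hitting_lines_def)
    have "inv g ` L \<in> lines"
      using euclidean_motion_lines[OF euclidean_motion_inverse(2)[OF assms] L(1)] .
    moreover have "inv g ` L \<inter> K \<noteq> {}"
    proof -
      obtain k where k: "k \<in> K" "g k \<in> L" using L(2) by blast
      have "inv g (g k) = k" using b by (simp add: bij_is_inj)
      then have "k \<in> inv g ` L" using k(2) by (metis image_eqI)
      with k(1) show ?thesis by blast
    qed
    moreover have "L = g ` (inv g ` L)"
      using b by (simp add: bij_is_surj image_f_inv_f)
    ultimately show "L \<in> (`) g ` hitting_lines K" by (auto simp: hitting_lines_def)
  qed
qed

lemma hitting_lines_Int_motion: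
  fixes g :: "real^'n \<Rightarrow> real^'n"
  assumes "euclidean_motion g"
  shows "(`) g ` (hitting_lines K \<inter> hitting_lines K') = hitting_lines (g ` K) \<inter> hitting_lines (g ` K')"
proof -
  have "inj ((`) g)"
    by (rule inj_on_image) (simp add: bij_is_inj[OF euclidean_motion_inverse(1)[OF assms]])
  then show ?thesis by (simp only: image_Int hitting_lines_motion[OF assms])
qed

lemma euclidean_motion_translation: "euclidean_motion ((+) a)"
  unfolding euclidean_motion_def by (intro exI[of _ a] exI[of _ "\<lambda>x. x"]) auto

lemma hitting_lines_mono: "K \<subseteq> K' \<Longrightarrow> hitting_lines K \<subseteq> hitting_lines K'"
  by (auto simp: hitting_lines_def)

lemma hitting_lines_UN: "hitting_lines (\<Union>i\<in>I. K i) = (\<Union>i\<in>I. hitting_lines (K i))"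
  by (auto simp: hitting_lines_def)

section \<open>Borel measurability of hitting sets\<close>

lemma space_line_borel: "space line_borel = lines"
  and sets_line_borel: "sets line_borel = sigma_sets lines {U. openin line_topology U}"
proof -
  have *: "{U. openin line_topology U} \<subseteq> Pow lines" by (auto simp: openin_line_topology)
  show "space line_borel = lines"
    "sets line_borel = sigma_sets lines {U. openin line_topology U}"
    unfolding line_borel_def using space_measure_of[OF *] sets_measure_of[OF *] by blast+
qed

lemma line_borel_diff_open:
  assumes "openin line_topology (lines - B)" "B \<subseteq> lines"
  shows "B \<in> sets line_borel"
proof -
  have "lines - (lines - B) \<in> sets line_borel"
    unfolding sets_line_borel by (rule sigma_sets.Compl) (use assms in auto)
  then show ?thesis using assms(2) by (simp add: double_diff)
qed

text \<open>The point lies on the line exactly if its offset from \<open>x\<close> equals the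
  projection of that offset onto \<open>u\<close>. Eliminating the line parameter leaves an equation
  continuous in point, base and direction.\<close>

lemma mem_line_through:
  assumes "norm u = 1"
  shows "k \<in> line_through x u \<longleftrightarrow> k - x = ((k - x) \<bullet> u) *\<^sub>R u"
proof
  assume "k \<in> line_through x u"
  then obtain t where t: "k = x + t *\<^sub>R u" by (auto simp: line_through_def)
  have "u \<bullet> u = 1" using assms by (simp add: norm_eq_1)
  then show "k - x = ((k - x) \<bullet> u) *\<^sub>R u" by (simp add: t)
next
  assume "k - x = ((k - x) \<bullet> u) *\<^sub>R u"
  then have "k = x + ((k - x) \<bullet> u) *\<^sub>R u" by (simp only: diff_eq_eq add.commute)
  then show "k \<in> line_through x u" unfolding line_through_def by (rule range_eqI)
qed

text \<open>The pairs (base, direction) whose line meets \<open>K\<close> form the projection, along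
  the compact factor \<open>K\<close>, of a closed set of triples; hence they are closed, and the
  lines missing \<open>K\<close> are open in the quotient topology.\<close>

lemma hitting_lines_in_sets:
  fixes K :: "(real^'n) set"
  assumes "compact K"
  shows "hitting_lines K \<in> sets line_borel"
proof (rule line_borel_diff_open)
  let ?S = "UNIV \<times> sphere 0 1 :: ((real^'n) \<times> (real^'n)) set"
  let ?C = "{z. fst z - fst (snd z) = ((fst z - fst (snd z)) \<bullet> snd (snd z)) *\<^sub>R snd (snd z)} :: ((real^'n) \<times> (real^'n) \<times> (real^'n)) set"
  have C: "closed ?C" by (intro closed_Collect_eq continuous_intros)
  have "closed {y. \<exists>k. k \<in> K \<and> (k, y) \<in> ?C}"
    using closed_compact_projection[OF assms C] .
  then have "openin (top_of_set ?S) (?S \<inter> - {y. \<exists>k. k \<in> K \<and> (k, y) \<in> ?C})"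
    by (intro openin_open_Int) (simp add: open_Compl)
  also have "?S \<inter> - {y. \<exists>k. k \<in> K \<and> (k, y) \<in> ?C} =
      {(x, u) \<in> UNIV \<times> sphere 0 1. line_through x u \<in> lines - hitting_lines K}"
  proof (intro set_eqI, clarify)
    fix x u :: "real^'n"
    have "line_through x u \<inter> K \<noteq> {} \<longleftrightarrow> (\<exists>k. k \<in> K \<and> k - x = ((k - x) \<bullet> u) *\<^sub>R u)"
      if "norm u = 1" using mem_line_through[OF that] by blast
    moreover have "line_through x u \<in> lines" if "norm u = 1"
      by (rule line_through_in_lines) (use that in auto)
    ultimately show "(x, u) \<in> ?S \<inter> - {y. \<exists>k. k \<in> K \<and> (k, y) \<in> ?C} \<longleftrightarrow>
      (x, u) \<in> {(x, u) \<in> UNIV \<times> sphere 0 1. line_through x u \<in> lines - hitting_lines K}"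
      by (auto simp: hitting_lines_def)
  qed
  finally show "openin line_topology (lines - hitting_lines K)"
    by (auto simp: openin_line_topology)
qed (auto simp: hitting_lines_def)

section \<open>Motion-invariant line measures\<close>

locale line_measure =
  fixes \<mu> :: "(real^'n) set measure"
  assumes invariant: "invariant_line_measure \<mu>"
begin

lemma sets_eq [measurable_cong]: "sets \<mu> = sets line_borel"
  using invariant by (simp add: invariant_line_measure_def)

lemma hitting_sets [intro, simp]: "compact K \<Longrightarrow> hitting_lines K \<in> sets \<mu>"
  by (simp add: sets_eq hitting_lines_in_sets)

lemma emeasure_motion:
  assumes "euclidean_motion g" "B \<in> sets \<mu>"
  shows "emeasure \<mu> ((`) g ` B) = emeasure \<mu> B"
  using invariant assms by (simp add: invariant_line_measure_def)

lemma emeasure_hitting_motion: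
  assumes "euclidean_motion g" "compact K"
  shows "emeasure \<mu> (hitting_lines (g ` K)) = emeasure \<mu> (hitting_lines K)"
  using emeasure_motion[OF assms(1) hitting_sets[OF assms(2)]] by (simp add: hitting_lines_motion assms(1))

lemma emeasure_hitting_cball:
  "emeasure \<mu> (hitting_lines (cball a r)) = emeasure \<mu> (hitting_lines (cball 0 r))"
  using emeasure_hitting_motion[OF euclidean_motion_translation, of "cball 0 r" a]
  by (simp add: cball_translation[symmetric])

text \<open>All balls of one radius are hit with equal measure, so a finite cover suffices. It
  serves twice: with \<open>r = 1\<close> it makes every compact set be hit with finite measure, and
  with \<open>K\<close> the unit ball it shows that small balls are hit with positive
  measure.\<close>

lemma emeasure_hitting_cover:
  assumes "compact K" "r > 0"
  obtains N :: nat where "emeasure \<mu> (hitting_lines K) \<le> of_nat N * emeasure \<mu> (hitting_lines (cball 0 r))"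
proof -
  obtain D where D: "finite D" "K \<subseteq> (\<Union>x\<in>D. ball x r)"
  proof (rule compactE_image[OF assms(1), of UNIV "\<lambda>x. ball x r"])
    show "K \<subseteq> (\<Union>x\<in>UNIV. ball x r)"
    proof
      fix x assume "x \<in> K"
      show "x \<in> (\<Union>x\<in>UNIV. ball x r)" by (rule UN_I[of x]) (use assms(2) in auto)
    qed
  qed auto
  have "hitting_lines K \<subseteq> (\<Union>x\<in>D. hitting_lines (cball x r))"
    unfolding hitting_lines_UN[symmetric] by (rule hitting_lines_mono) (use D(2) ball_subset_cball in blast)
  then have "emeasure \<mu> (hitting_lines K) \<le> emeasure \<mu> (\<Union>x\<in>D. hitting_lines (cball x r))"
    by (rule emeasure_mono) (use D(1) in auto)
  also have "\<dots> \<le> (\<Sum>x\<in>D. emeasure \<mu> (hitting_lines (cball x r)))"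
    by (rule emeasure_subadditive_finite) (use D(1) in auto)
  also have "\<dots> = of_nat (card D) * emeasure \<mu> (hitting_lines (cball 0 r))"
    by (subst emeasure_hitting_cball) simp
  finally show thesis by (rule that)
qed

lemma emeasure_unit_ball:
  "emeasure \<mu> (hitting_lines (cball 0 1)) = ennreal (unit_ball_vol (real (CARD('n) - 1)))"
  using invariant by (simp add: invariant_line_measure_def)

lemma emeasure_unit_ball_pos: "0 < emeasure \<mu> (hitting_lines (cball 0 1))"
  unfolding emeasure_unit_ball by simp

lemma emeasure_hitting_finite:
  assumes "compact K"
  shows "emeasure \<mu> (hitting_lines K) < \<infinity>"
proof -
  obtain N where "emeasure \<mu> (hitting_lines K) \<le> of_nat N * emeasure \<mu> (hitting_lines (cball 0 1))"
    using emeasure_hitting_cover[OF assms zero_less_one] .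
  also have "\<dots> < \<infinity>" unfolding emeasure_unit_ball
    by (simp add: ennreal_mult_less_top of_nat_less_top)
  finally show ?thesis .
qed

lemma hitting_fmeasurable [intro, simp]: "compact K \<Longrightarrow> hitting_lines K \<in> fmeasurable \<mu>"
  by (simp add: fmeasurable_def emeasure_hitting_finite[simplified])

lemma measure_hitting_cball_pos:
  assumes "r > 0"
  shows "0 < measure \<mu> (hitting_lines (cball 0 r))"
proof -
  obtain N where "emeasure \<mu> (hitting_lines (cball 0 1)) \<le> of_nat N * emeasure \<mu> (hitting_lines (cball 0 r))"
    using emeasure_hitting_cover[OF compact_cball assms] .
  then have "emeasure \<mu> (hitting_lines (cball 0 r)) \<noteq> 0"
    using emeasure_unit_ball_pos by (metis leD mult_zero_right)
  then show ?thesis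
    using emeasure_hitting_finite[OF compact_cball, of 0 r]
    by (simp add: measure_def enn2real_positive_iff zero_less_iff_neq_zero)
qed

lemma measure_hitting_translation:
  "compact K \<Longrightarrow> measure \<mu> (hitting_lines ((+) a ` K)) = measure \<mu> (hitting_lines K)"
  by (simp add: measure_def emeasure_hitting_motion euclidean_motion_translation)

lemma measure_hitting_cball:
  "measure \<mu> (hitting_lines (cball a r)) = measure \<mu> (hitting_lines (cball 0 r))"
  by (simp add: measure_def emeasure_hitting_cball[of a])

text \<open>Motions act transitively on pairs of points at a given distance: an orthogonal map
  aligns the difference vectors and a translation matches the base points.\<close>

lemma measure_hitting_two_cballs:
  assumes "dist x y = dist x' y'"
  shows "measure \<mu> (hitting_lines (cball x r) \<inter> hitting_lines (cball y r)) =
    measure \<mu> (hitting_lines (cball x' r) \<inter> hitting_lines (cball y' r))"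
proof -
  have "norm (y - x) = norm (y' - x')" using assms by (simp add: dist_norm norm_minus_commute)
  then obtain f where f: "orthogonal_transformation f" "f (y - x) = y' - x'"
    by (rule orthogonal_transformation_exists)
  have l: "linear f" using f(1) by (simp add: orthogonal_transformation)
  let ?g = "\<lambda>z. (x' - f x) + f z"
  have g: "euclidean_motion ?g" unfolding euclidean_motion_def
    by (intro exI[of _ "x' - f x"] exI[of _ f]) (simp add: f(1))
  have im: "?g ` cball z r = cball (?g z) r" for z
  proof -
    have "?g ` cball z r = (+) (x' - f x) ` (f ` cball z r)" by (simp add: image_image)
    also have "\<dots> = cball (?g z) r"
      by (simp only: image_orthogonal_transformation_cball[OF f(1)] cball_translation[symmetric])
    finally show ?thesis .
  qed
  have gx: "?g x = x'" "?g y = y'" using f(2) by (simp_all add: linear_diff[OF l] algebra_simps)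
  have "emeasure \<mu> ((`) ?g ` (hitting_lines (cball x r) \<inter> hitting_lines (cball y r))) =
     emeasure \<mu> (hitting_lines (cball x r) \<inter> hitting_lines (cball y r))"
    by (rule emeasure_motion[OF g]) auto
  then show ?thesis
    by (simp only: hitting_lines_Int_motion[OF g] im gx measure_def)
qed

end

section \<open>Lines hitting separated balls in dimension at least three\<close>

text \<open>Bonferroni's inequality one event at a time: each new event has mass at least
  \<open>b\<close> and loses at most \<open>b / 2\<close> to its overlaps with the earlier
  ones.\<close>

lemma measure_UN_ge_half_sum:
  assumes "\<And>k. k < m \<Longrightarrow> E k \<in> fmeasurable M"
    and "\<And>k. k < m \<Longrightarrow> b \<le> measure M (E k)"
    and "\<And>k. k < m \<Longrightarrow> (\<Sum>l<k. measure M (E l \<inter> E k)) \<le> b / 2"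
  shows "real m * (b / 2) \<le> measure M (\<Union>k<m. E k)"
  using assms
proof (induction m)
  case 0
  then show ?case by simp
next
  case (Suc m)
  let ?A = "\<Union>k<m. E k"
  have A: "?A \<in> fmeasurable M" using Suc.prems(1) by (intro fmeasurable.finite_UN) auto
  have "measure M (?A \<inter> E m) = measure M (\<Union>l<m. E l \<inter> E m)" by (simp add: Int_UN_distrib2)
  also have "\<dots> \<le> (\<Sum>l<m. measure M (E l \<inter> E m))"
    using Suc.prems(1) by (intro measure_UNION_le) (auto intro!: fmeasurableD fmeasurable.Int)
  also have "\<dots> \<le> b / 2" using Suc.prems(3) by simp
  finally have "measure M (?A \<inter> E m) \<le> b / 2" .
  moreover have "measure M (?A \<union> E m) = measure M ?A + measure M (E m) - measure M (?A \<inter> E m)"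
    using A Suc.prems(1) by (intro measure_Un3) auto
  moreover have "real m * (b / 2) \<le> measure M ?A" using Suc by simp
  moreover have "b \<le> measure M (E m)" using Suc.prems(2) by simp
  moreover have "(\<Union>k<Suc m. E k) = ?A \<union> E m" by (auto simp: less_Suc_eq)
  ultimately show ?case by (simp add: field_simps)
qed

lemma sum_inverse_square_le: "(\<Sum>l<k. 1 / (real (k - l))\<^sup>2) \<le> 2"
proof -
  \<comment> \<open>The term \<open>1 / real (Suc k)\<close> strengthens the claim so that the
    induction telescopes.\<close>
  have *: "(\<Sum>j<Suc k. 1 / (real (Suc j))\<^sup>2) \<le> 2 - 1 / real (Suc k)" for k
  proof (induction k)
    case (Suc k)
    have "1 / (real (Suc (Suc k)))\<^sup>2 \<le> 1 / (real (Suc k) * real (Suc (Suc k)))"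
      by (rule divide_left_mono) (auto simp: power2_eq_square)
    also have "\<dots> = 1 / real (Suc k) - 1 / real (Suc (Suc k))"
      by (simp add: field_simps)
    finally show ?case using Suc by simp
  qed simp
  have "(\<Sum>l<k. 1 / (real (k - l))\<^sup>2) = (\<Sum>l<k. 1 / (real (Suc (k - Suc l)))\<^sup>2)"
    by (intro sum.cong) (auto simp: Suc_diff_Suc)
  also have "\<dots> = (\<Sum>j<k. 1 / (real (Suc j))\<^sup>2)"
    by (rule sum.nat_diff_reindex)
  also have "\<dots> \<le> 2"
  proof (cases k)
    case (Suc j)
    then show ?thesis using *[of j] by (smt (verit) divide_nonneg_nonneg of_nat_0_le_iff)
  qed simp
  finally show ?thesis .
qed

text \<open>A line passing near the origin stays close to a line through the origin, which meets a
  given sphere about 0 only in two antipodal points. So \<open>y\<close> and \<open>y'\<close> are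
  close to each other or nearly opposite.\<close>

lemma line_hits_three_balls:
  fixes y y' :: "real^'n"
  assumes L: "L \<in> lines" and hit: "L \<inter> cball 0 (1/2) \<noteq> {}" "L \<inter> cball y (1/2) \<noteq> {}" "L \<inter> cball y' (1/2) \<noteq> {}"
    and norm: "norm y = norm y'"
  shows "norm (y - y') \<le> 4 \<or> norm (y + y') \<le> 4"
proof -
  obtain p where p: "p \<in> L" "norm p \<le> 1/2" using hit(1) by auto
  obtain u where u: "norm u = 1" "L = line_through p u" using lines_obtain_direction[OF L p(1)] .
  \<comment> \<open>Translating the line by \<open>- p\<close> makes it pass through 0 and costs
    another 1/2.\<close>
  have near: "\<exists>t. norm (z - t *\<^sub>R u) \<le> 1" if "L \<inter> cball z (1/2) \<noteq> {}" for z
  proof -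
    obtain t where t: "norm (z - (p + t *\<^sub>R u)) \<le> 1/2"
      using \<open>L \<inter> cball z (1/2) \<noteq> {}\<close> by (auto simp: u(2) line_through_def dist_norm)
    have "norm (z - t *\<^sub>R u) \<le> norm (z - (p + t *\<^sub>R u)) + norm p"
      by (rule order_trans[OF _ norm_triangle_ineq]) simp
    then show ?thesis using t p(2) by (intro exI[of _ t]) simp
  qed
  obtain t t' where t: "norm (y - t *\<^sub>R u) \<le> 1" and t': "norm (y' - t' *\<^sub>R u) \<le> 1"
    using near[OF hit(2)] near[OF hit(3)] by blast
  have "\<bar>norm y - norm (t *\<^sub>R u)\<bar> \<le> 1" "\<bar>norm y' - norm (t' *\<^sub>R u)\<bar> \<le> 1"
    by (rule order_trans[OF norm_triangle_ineq3 t], rule order_trans[OF norm_triangle_ineq3 t'])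
  then have abs: "\<bar>norm y - \<bar>t\<bar>\<bar> \<le> 1" "\<bar>norm y - \<bar>t'\<bar>\<bar> \<le> 1" using u(1) norm by simp_all
  have d: "norm (y - y') \<le> norm (y - t *\<^sub>R u) + norm (y' - t' *\<^sub>R u) + \<bar>t - t'\<bar>"
  proof -
    have "y - y' = (y - t *\<^sub>R u) - (y' - t' *\<^sub>R u) + (t - t') *\<^sub>R u" by (simp add: algebra_simps)
    note e = this
    have "norm (y - y') \<le> norm ((y - t *\<^sub>R u) - (y' - t' *\<^sub>R u)) + norm ((t - t') *\<^sub>R u)"
      unfolding e by (rule norm_triangle_ineq)
    also have "norm ((y - t *\<^sub>R u) - (y' - t' *\<^sub>R u)) \<le> norm (y - t *\<^sub>R u) + norm (y' - t' *\<^sub>R u)"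
      by (rule norm_triangle_ineq4)
    finally show ?thesis using u(1) by simp
  qed
  have s: "norm (y + y') \<le> norm (y - t *\<^sub>R u) + norm (y' - t' *\<^sub>R u) + \<bar>t + t'\<bar>"
  proof -
    have "y + y' = (y - t *\<^sub>R u) + (y' - t' *\<^sub>R u) + (t + t') *\<^sub>R u" by (simp add: algebra_simps)
    note e = this
    have "norm (y + y') \<le> norm ((y - t *\<^sub>R u) + (y' - t' *\<^sub>R u)) + norm ((t + t') *\<^sub>R u)"
      unfolding e by (rule norm_triangle_ineq)
    also have "norm ((y - t *\<^sub>R u) + (y' - t' *\<^sub>R u)) \<le> norm (y - t *\<^sub>R u) + norm (y' - t' *\<^sub>R u)"
      by (rule norm_triangle_ineq)
    finally show ?thesis using u(1) by simp
  qed
  \<comment> \<open>Both absolute values lie within 1 of the common norm. With the two errors of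
    size 1 this gives the constant 4.\<close>
  have "\<bar>t - t'\<bar> \<le> 2 \<or> \<bar>t + t'\<bar> \<le> 2" using abs by linarith
  then show ?thesis using d s t t' by linarith
qed

context line_measure
begin

text \<open>Packing argument: put (N + 1) squared centres on the sphere of radius \<open>r\<close>
  about 0. Each centre gives a joint event with the ball at 0 of the same measure \<open>p\<close>,
  and the events are disjoint subsets of the lines hitting that ball, so (N + 1) squared times
  \<open>p\<close> is bounded.\<close>

lemma measure_hitting_two_cballs_le:
  assumes card: "CARD('n) \<ge> 3" and far: "dist x y \<ge> 30"
  shows "measure \<mu> (hitting_lines (cball x (1/2)) \<inter> hitting_lines (cball y (1/2))) \<le>
    100 / (dist x y)\<^sup>2 * measure \<mu> (hitting_lines (cball 0 (1/2)))"
proof -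
  define r where "r = dist x y"
  \<comment> \<open>Small enough that grid coordinates stay below \<open>r / 2\<close>, which keeps
    the third coordinate at least \<open>r / 2\<close>; large enough that
    \<open>r / 10 \<le> N + 1\<close>, whence the factor 100.\<close>
  define N where "N = nat \<lfloor>r / 10\<rfloor>"
  define p where "p = measure \<mu> (hitting_lines (cball x (1/2)) \<inter> hitting_lines (cball y (1/2)))"
  have r: "r \<ge> 30" using far by (simp add: r_def)
  obtain i j k :: 'n where ijk: "i \<noteq> j" "i \<noteq> k" "j \<noteq> k"
  proof -
    obtain T :: "'n set" where "card T = 3" using obtain_subset_with_card_n[OF card] by metis
    then show thesis using that by (auto simp: card_3_iff)
  qed
  \<comment> \<open>A planar grid in the coordinates \<open>i\<close>, \<open>j\<close> lifted to
    the sphere by the coordinate \<open>k\<close>. The spacing 5 exceeds the distance 4 allowed by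
    \<open>line_hits_three_balls\<close>.\<close>
  define P :: "nat \<times> nat \<Rightarrow> real^'n" where
    "P = (\<lambda>(a, b). axis i (5 * real a) + axis j (5 * real b) + axis k (sqrt (r\<^sup>2 - (5 * real a)\<^sup>2 - (5 * real b)\<^sup>2)))"
  define I where "I = {0..N} \<times> {0..N}"
  have le: "(5 * real a)\<^sup>2 \<le> r\<^sup>2 / 4" if "a \<le> N" for a
  proof -
    have "real N \<le> r / 10" unfolding N_def by (rule of_nat_floor) (use r in simp)
    moreover have "real a \<le> real N" using that by simp
    ultimately have "5 * real a \<le> r / 2" by linarith
    then have "(5 * real a)\<^sup>2 \<le> (r / 2)\<^sup>2" by (intro power_mono) auto
    then show ?thesis by (simp add: power_divide)
  qed
  have root: "r / 2 \<le> sqrt (r\<^sup>2 - (5 * real a)\<^sup>2 - (5 * real b)\<^sup>2)" if "a \<le> N" "b \<le> N" for a b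
  proof (rule real_le_rsqrt)
    have "(r / 2)\<^sup>2 = r\<^sup>2 / 4" by (simp add: power_divide)
    then show "(r / 2)\<^sup>2 \<le> r\<^sup>2 - (5 * real a)\<^sup>2 - (5 * real b)\<^sup>2"
      using le[OF that(1)] le[OF that(2)] zero_le_power2[of r] by linarith
  qed
  have normP: "norm (P z) = r" if "z \<in> I" for z
  proof -
    obtain a b where z: "z = (a, b)" "a \<le> N" "b \<le> N" using \<open>z \<in> I\<close> by (auto simp: I_def)
    have "0 \<le> r\<^sup>2 - (5 * real a)\<^sup>2 - (5 * real b)\<^sup>2"
      using le[OF z(2)] le[OF z(3)] zero_le_power2[of r] by linarith
    then have "P z \<bullet> P z = r\<^sup>2"
      using ijk by (simp add: z P_def inner_add_left inner_add_right inner_axis_axis power2_eq_square)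
    then show ?thesis using r by (simp add: norm_eq_sqrt_inner)
  qed
  have comp: "P (a, b) $ i = 5 * real a" "P (a, b) $ j = 5 * real b"
    "P (a, b) $ k = sqrt (r\<^sup>2 - (5 * real a)\<^sup>2 - (5 * real b)\<^sup>2)" for a b
    using ijk by (simp_all add: P_def axis_def)
  have sep: "norm (P z - P w) \<ge> 5" if "z \<noteq> w" for z w
  proof -
    obtain a b a' b' where z: "z = (a, b)" "w = (a', b')" by fastforce
    have "\<bar>P z $ i - P w $ i\<bar> \<le> norm (P z - P w)" "\<bar>P z $ j - P w $ j\<bar> \<le> norm (P z - P w)"
      using component_le_norm_cart[of "P z - P w"] by simp_all
    moreover have "5 \<le> \<bar>P z $ i - P w $ i\<bar> \<or> 5 \<le> \<bar>P z $ j - P w $ j\<bar>"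
      using that unfolding z by (simp add: comp) linarith
    ultimately show ?thesis by linarith
  qed
  \<comment> \<open>All centres lie on the same cap, with \<open>k\<close>-coordinate at least
    \<open>r / 2\<close>, so no two are nearly antipodal.\<close>
  have opp: "norm (P z + P w) \<ge> 30" if "z \<in> I" "w \<in> I" for z w
  proof -
    obtain a b a' b' where z: "z = (a, b)" "w = (a', b')" by fastforce
    have "\<bar>P z $ k + P w $ k\<bar> \<le> norm (P z + P w)"
      using component_le_norm_cart[of "P z + P w"] by simp
    moreover have "r / 2 \<le> P z $ k" "r / 2 \<le> P w $ k"
      using that root by (simp_all add: z comp I_def)
    ultimately show ?thesis using r by linarith
  qed
  define E where "E z = hitting_lines (cball 0 (1/2)) \<inter> hitting_lines (cball (P z) (1/2))" for z
  have "disjoint_family_on E I"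
    unfolding disjoint_family_on_def
  proof (intro ballI impI, rule ccontr)
    fix z w assume zw: "z \<in> I" "w \<in> I" "z \<noteq> w" "E z \<inter> E w \<noteq> {}"
    then obtain L where "L \<in> lines" "L \<inter> cball 0 (1/2) \<noteq> {}" "L \<inter> cball (P z) (1/2) \<noteq> {}"
      "L \<inter> cball (P w) (1/2) \<noteq> {}" by (auto simp: E_def hitting_lines_def)
    then have "norm (P z - P w) \<le> 4 \<or> norm (P z + P w) \<le> 4"
      using normP zw by (intro line_hits_three_balls) auto
    then show False using sep[of z w] opp[of z w] zw by linarith
  qed
  moreover have E: "E z \<in> fmeasurable \<mu>" for z unfolding E_def by auto
  ultimately have "(\<Sum>z\<in>I. measure \<mu> (E z)) = measure \<mu> (\<Union>z\<in>I. E z)"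
    by (intro measure_finite_Union[symmetric]) (auto simp: I_def fmeasurable_def less_top[symmetric])
  also have "\<dots> \<le> measure \<mu> (hitting_lines (cball 0 (1/2)))"
    using E by (intro measure_mono_fmeasurable) (auto simp: E_def I_def intro!: sets.finite_UN fmeasurableD fmeasurable.Int)
  also have "(\<Sum>z\<in>I. measure \<mu> (E z)) = (\<Sum>z\<in>I. p)"
  proof (rule sum.cong[OF refl])
    fix z assume "z \<in> I"
    then have "dist 0 (P z) = dist x y" using normP r_def by simp
    then show "measure \<mu> (E z) = p" unfolding E_def p_def by (rule measure_hitting_two_cballs)
  qed
  also have "\<dots> = (real N + 1)\<^sup>2 * p" by (simp add: I_def power2_eq_square card_cartesian_product algebra_simps)
  finally have *: "(real N + 1)\<^sup>2 * p \<le> measure \<mu> (hitting_lines (cball 0 (1/2)))" .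
  have "r / 10 \<le> real N + 1" using r unfolding N_def by linarith
  then have "(r / 10)\<^sup>2 \<le> (real N + 1)\<^sup>2" using r by (intro power_mono) auto
  then have "(r / 10)\<^sup>2 * p \<le> (real N + 1)\<^sup>2 * p" by (rule mult_right_mono) (simp add: p_def)
  with * have "(r / 10)\<^sup>2 * p \<le> measure \<mu> (hitting_lines (cball 0 (1/2)))" by linarith
  then have "p * r\<^sup>2 \<le> 100 * measure \<mu> (hitting_lines (cball 0 (1/2)))"
    by (simp add: power_divide field_simps)
  moreover have "0 < r\<^sup>2" using r by simp
  ultimately show ?thesis by (simp add: p_def[symmetric] r_def[symmetric] pos_le_divide_eq)
qed

text \<open>Spacing 30 puts every pair in the range of the two-ball bound and makes its constant 100
  / 900 = 1/9. Since the inverse squares sum to at most 2, the overlaps total at most 2/9 of one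
  ball, below the required half.\<close>

lemma measure_hitting_separated_ge:
  assumes "CARD('n) \<ge> 3"
    and "\<And>l k. l < k \<Longrightarrow> k < m \<Longrightarrow> 30 * real (k - l) \<le> dist (z l) (z k)"
  shows "real m * (measure \<mu> (hitting_lines (cball 0 (1/2))) / 2) \<le>
    measure \<mu> (\<Union>k<m. hitting_lines (cball (z k) (1/2)))"
proof (rule measure_UN_ge_half_sum)
  let ?b = "measure \<mu> (hitting_lines (cball 0 (1/2)))"
  fix k assume k: "k < m"
  show "hitting_lines (cball (z k) (1/2)) \<in> fmeasurable \<mu>" by simp
  show "?b \<le> measure \<mu> (hitting_lines (cball (z k) (1/2)))" by (simp add: measure_hitting_cball[of "z k"])
  have "(\<Sum>l<k. measure \<mu> (hitting_lines (cball (z l) (1/2)) \<inter> hitting_lines (cball (z k) (1/2))))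
      \<le> (\<Sum>l<k. (1 / (real (k - l))\<^sup>2) * (?b / 9))"
  proof (rule sum_mono)
    fix l assume "l \<in> {..<k}"
    then have l: "30 * real (k - l) \<le> dist (z l) (z k)" "real (k - l) \<ge> 1" using assms(2)[of l k] k by auto
    then have "measure \<mu> (hitting_lines (cball (z l) (1/2)) \<inter> hitting_lines (cball (z k) (1/2)))
        \<le> 100 / (dist (z l) (z k))\<^sup>2 * ?b"
      by (intro measure_hitting_two_cballs_le assms(1)) linarith
    also have "\<dots> \<le> 100 / (30 * real (k - l))\<^sup>2 * ?b"
    proof -
      have le: "(30 * real (k - l))\<^sup>2 \<le> (dist (z l) (z k))\<^sup>2" by (rule power_mono[OF l(1)]) simp
      have "0 < (30 * real (k - l))\<^sup>2" using l(2) by simp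
      then have "100 / (dist (z l) (z k))\<^sup>2 \<le> 100 / (30 * real (k - l))\<^sup>2"
        by (rule frac_le[OF zero_le_numeral order_refl _ le])
      then show ?thesis by (rule mult_right_mono) simp
    qed
    also have "\<dots> = (1 / (real (k - l))\<^sup>2) * (?b / 9)" by (simp add: power_mult_distrib)
    finally show "measure \<mu> (hitting_lines (cball (z l) (1/2)) \<inter> hitting_lines (cball (z k) (1/2))) \<le> (1 / (real (k - l))\<^sup>2) * (?b / 9)" .
  qed
  also have "\<dots> = (\<Sum>l<k. 1 / (real (k - l))\<^sup>2) * (?b / 9)" by (simp only: sum_distrib_right)
  also have "\<dots> \<le> 2 * (?b / 9)" by (intro mult_right_mono sum_inverse_square_le) simp
  also have "\<dots> \<le> ?b / 2" by simp
  finally show "(\<Sum>l<k. measure \<mu> (hitting_lines (cball (z l) (1/2)) \<inter> hitting_lines (cball (z k) (1/2)))) \<le> ?b / 2" .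
qed

end

section \<open>Lattice clusters and their boundaries\<close>

lemma real_vec_component [simp]: "real_vec z $ i = real_of_int (z $ i)"
  by (simp add: real_vec_def)

lemma real_vec_0 [simp]: "real_vec 0 = 0"
  by (simp add: vec_eq_iff)

text \<open>The squared distance is an integer sum of squares; it equals 1 only if a single summand
  is 1 and the others vanish.\<close>

lemma neighbours_iff:
  "neighbours x y \<longleftrightarrow> (\<exists>i. \<bar>x $ i - y $ i\<bar> = 1 \<and> (\<forall>j. j \<noteq> i \<longrightarrow> x $ j = y $ j))"
proof -
  let ?S = "\<Sum>i\<in>UNIV. (x $ i - y $ i)\<^sup>2"
  have "norm (real_vec x - real_vec y) = sqrt (of_int ?S)"
    by (simp add: norm_vec_def L2_set_def)
  then have *: "neighbours x y \<longleftrightarrow> ?S = 1"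
    by (simp add: neighbours_def del: of_int_sum)
  show ?thesis
  proof
    assume "neighbours x y"
    then have S: "?S = 1" using * by simp
    then have "\<exists>i. x $ i \<noteq> y $ i" by (metis (mono_tags, lifting) cancel_comm_monoid_add_class.diff_cancel sum.neutral zero_neq_one zero_power2)
    then obtain i where i: "x $ i \<noteq> y $ i" ..
    have split: "?S = (x $ i - y $ i)\<^sup>2 + (\<Sum>j\<in>UNIV - {i}. (x $ j - y $ j)\<^sup>2)"
      by (simp add: sum.remove)
    have nn: "0 \<le> (\<Sum>j\<in>UNIV - {i}. (x $ j - y $ j)\<^sup>2)" by (intro sum_nonneg) simp
    have "0 < (x $ i - y $ i)\<^sup>2" using i by simp
    then have 1: "(x $ i - y $ i)\<^sup>2 = 1" "(\<Sum>j\<in>UNIV - {i}. (x $ j - y $ j)\<^sup>2) = 0"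
      using S split nn by linarith+
    have "\<forall>j\<in>UNIV - {i}. (x $ j - y $ j)\<^sup>2 = 0"
      using 1(2) sum_nonneg_eq_0_iff[of "UNIV - {i}" "\<lambda>j. (x $ j - y $ j)\<^sup>2"] by simp
    moreover have "\<bar>x $ i - y $ i\<bar> = 1" using 1(1) by (simp add: power2_eq_1_iff) linarith
    ultimately show "\<exists>i. \<bar>x $ i - y $ i\<bar> = 1 \<and> (\<forall>j. j \<noteq> i \<longrightarrow> x $ j = y $ j)" by auto
  next
    assume "\<exists>i. \<bar>x $ i - y $ i\<bar> = 1 \<and> (\<forall>j. j \<noteq> i \<longrightarrow> x $ j = y $ j)"
    then obtain i where i: "\<bar>x $ i - y $ i\<bar> = 1" "\<And>j. j \<noteq> i \<Longrightarrow> x $ j = y $ j" by auto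
    have "?S = (x $ i - y $ i)\<^sup>2 + (\<Sum>j\<in>UNIV - {i}. (x $ j - y $ j)\<^sup>2)"
      by (simp add: sum.remove)
    also have "(\<Sum>j\<in>UNIV - {i}. (x $ j - y $ j)\<^sup>2) = 0" using i(2) by (intro sum.neutral) auto
    also have "(x $ i - y $ i)\<^sup>2 = 1" using i(1) by (metis one_power2 power2_abs)
    finally show "neighbours x y" using * by simp
  qed
qed

lemma neighbours_sym: "neighbours x y \<longleftrightarrow> neighbours y x"
  by (simp add: neighbours_def norm_minus_commute)

lemma finite_vec_components:
  fixes S :: "'n::finite \<Rightarrow> 'a set"
  assumes "\<And>i. finite (S i)"
  shows "finite {w :: 'a^'n. \<forall>i. w $ i \<in> S i}"
proof (rule finite_surj)
  show "finite (Pi\<^sub>E UNIV S)" using assms by (intro finite_PiE) auto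
  show "{w :: 'a^'n. \<forall>i. w $ i \<in> S i} \<subseteq> vec_lambda ` Pi\<^sub>E UNIV S"
  proof
    fix w :: "'a^'n" assume "w \<in> {w. \<forall>i. w $ i \<in> S i}"
    then show "w \<in> vec_lambda ` Pi\<^sub>E UNIV S" by (intro image_eqI[of _ _ "vec_nth w"]) auto
  qed
qed

lemma finite_unit_vectors: "finite {e :: int^'n. neighbours e 0}"
proof (rule finite_subset)
  show "finite {e :: int^'n. \<forall>i. e $ i \<in> {- 1..1}}" by (rule finite_vec_components) simp
  show "{e :: int^'n. neighbours e 0} \<subseteq> {e. \<forall>i. e $ i \<in> {- 1..1}}"
  proof clarify
    fix e :: "int^'n" and i assume "neighbours e 0"
    then obtain k where "\<bar>e $ k\<bar> = 1" "\<And>j. j \<noteq> k \<Longrightarrow> e $ j = 0" by (auto simp: neighbours_iff)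
    then show "e $ i \<in> {- 1..1}" by (cases "i = k") auto
  qed
qed

lemma neighbours_translate: "{y. neighbours y x} = (+) x ` {e. neighbours e 0}"
proof (intro set_eqI iffI)
  fix y assume "y \<in> {y. neighbours y x}"
  then have "y - x \<in> {e. neighbours e 0}" by (simp add: neighbours_iff)
  then show "y \<in> (+) x ` {e. neighbours e 0}" by (intro image_eqI[of _ _ "y - x"]) auto
qed (auto simp: neighbours_iff)

lemma finite_neighbours: "finite {y. neighbours y x}"
  by (subst neighbours_translate) (rule finite_imageI[OF finite_unit_vectors])

lemma card_neighbours: "card {y. neighbours y x} = card {e. neighbours e (0 :: int^'n)}" for x :: "int^'n"
  by (subst neighbours_translate) (rule card_image, simp)

lemma outer_boundary_subset: "outer_boundary A \<subseteq> (\<Union>x\<in>A. {y. neighbours y x})"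
  by (auto simp: outer_boundary_def)

lemma finite_outer_boundary: "finite A \<Longrightarrow> finite (outer_boundary A)"
  by (rule finite_subset[OF outer_boundary_subset]) (simp add: finite_neighbours)

text \<open>Connectedness is encoded by a growth history from the origin, not by paths, so that its
  consequences are plain inductions. \<open>AE_cluster\<close> shows that the process stays among
  these sets almost surely.\<close>

inductive cluster :: "(int^'n) set \<Rightarrow> bool" where
  origin: "cluster {0}"
| grow: "cluster A \<Longrightarrow> z \<in> outer_boundary A \<Longrightarrow> cluster (insert z A)"

lemma cluster_finite: "cluster A \<Longrightarrow> finite A"
  by (induction rule: cluster.induct) auto

lemma cluster_origin: "cluster A \<Longrightarrow> 0 \<in> A"
  by (induction rule: cluster.induct) auto

text \<open>Discrete intermediate value property: a newly attached site differs by at most 1 in each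
  coordinate from an old one, so no integer level is jumped over.\<close>

lemma cluster_levels:
  assumes "cluster A" "x \<in> A" "0 \<le> t \<and> t \<le> x $ i \<or> x $ i \<le> t \<and> t \<le> 0"
  shows "\<exists>w\<in>A. w $ i = t"
  using assms
proof (induction arbitrary: x rule: cluster.induct)
  case (grow A z)
  show ?case
  proof (cases "x \<in> A \<or> t = x $ i")
    case True
    then show ?thesis using grow.IH grow.prems by blast
  next
    case False
    then have x: "x = z" "t \<noteq> x $ i" using grow.prems(1) by auto
    obtain y where y: "y \<in> A" "neighbours z y" using grow.hyps(2) by (auto simp: outer_boundary_def)
    have "\<bar>z $ i - y $ i\<bar> \<le> 1"
    proof -
      obtain k where "\<bar>z $ k - y $ k\<bar> = 1" "\<And>j. j \<noteq> k \<Longrightarrow> z $ j = y $ j"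
        using y(2) by (auto simp: neighbours_iff)
      then show ?thesis by (cases "i = k") auto
    qed
    then have "0 \<le> t \<and> t \<le> y $ i \<or> y $ i \<le> t \<and> t \<le> 0" using grow.prems(2) x by auto
    then show ?thesis using grow.IH[OF y(1)] by blast
  qed
qed auto

text \<open>Connectedness in the form needed for separation arguments: a locally constant function
  is constant. It is applied to the side of a line on which a site lies.\<close>

lemma cluster_invariant:
  assumes "cluster A" "\<And>z w. z \<in> A \<Longrightarrow> w \<in> A \<Longrightarrow> neighbours z w \<Longrightarrow> P z = P w" "x \<in> A"
  shows "P x = P 0"
  using assms
proof (induction arbitrary: x rule: cluster.induct)
  case (grow A z)
  then obtain y where y: "y \<in> A" "neighbours z y" by (auto simp: outer_boundary_def)
  have IH: "P w = P 0" if "w \<in> A" for w using grow.IH that grow.prems(1) by blast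
  then show ?case using grow.prems y by (metis insert_iff)
qed simp

text \<open>Walking from \<open>w\<close> in direction \<open>j\<close> keeps the
  \<open>i\<close>-th coordinate and must leave the finite set; the first site outside is a boundary
  site.\<close>

lemma outer_boundary_level:
  fixes A :: "(int^'n) set"
  assumes "finite A" "w \<in> A" "j \<noteq> i"
  obtains w' where "w' \<in> outer_boundary A" "w' $ i = w $ i"
proof -
  let ?p = "\<lambda>n::nat. w + axis j (int n)"
  have "inj ?p" by (auto simp: inj_def axis_eq_axis)
  then have "infinite (range ?p)" by (rule range_inj_infinite)
  then have ex: "\<exists>n. ?p n \<notin> A" using assms(1) by (meson finite_subset image_subsetI)
  define n where "n = (LEAST n. ?p n \<notin> A)"
  have n: "?p n \<notin> A" unfolding n_def using ex by (rule LeastI_ex)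
  have "w + axis j (int 0) = w" by (simp add: vec_eq_iff axis_def)
  then have "n \<noteq> 0" using n assms(2) by metis
  then obtain m where m: "n = Suc m" using not0_implies_Suc by blast
  have "?p m \<in> A" using not_less_Least[of m "\<lambda>n. ?p n \<notin> A"] m by (simp add: n_def)
  moreover have "neighbours (?p n) (?p m)"
    unfolding neighbours_iff by (rule exI[of _ j]) (simp add: m axis_def)
  ultimately have "?p n \<in> outer_boundary A" using n by (auto simp: outer_boundary_def)
  moreover have "?p n $ i = w $ i" using assms(3) by (simp add: axis_def)
  ultimately show thesis by (rule that)
qed

section \<open>Boxes around lattice sites\<close>

lemma mem_box_at: "x \<in> box_at z \<longleftrightarrow> (\<forall>i. \<bar>x $ i - real_of_int (z $ i)\<bar> \<le> 1/2)"
proof -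
  have "x \<in> box_at z \<longleftrightarrow> x - real_vec z \<in> cbox (\<chi> i. - 1/2) (\<chi> i. 1/2)"
  proof
    assume "x - real_vec z \<in> cbox (\<chi> i. - 1/2) (\<chi> i. 1/2)"
    then show "x \<in> box_at z"
      unfolding box_at_def by (intro image_eqI[of _ _ "x - real_vec z"]) auto
  qed (auto simp: box_at_def)
  also have "\<dots> \<longleftrightarrow> (\<forall>i. \<bar>x $ i - real_of_int (z $ i)\<bar> \<le> 1/2)"
  proof -
    have "- 1/2 \<le> t \<and> t \<le> 1/2 \<longleftrightarrow> \<bar>t\<bar> \<le> 1/2" for t :: real by linarith
    then show ?thesis by (simp only: mem_box_cart vec_lambda_beta vector_minus_component real_vec_component)
  qed
  finally show ?thesis .
qed

lemma cball_subset_box_at: "cball (real_vec z) (1/2) \<subseteq> box_at z"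
proof
  fix x assume x: "x \<in> cball (real_vec z) (1/2)"
  then have "norm (x - real_vec z) \<le> 1/2" by (simp add: dist_norm norm_minus_commute)
  then have "\<bar>(x - real_vec z) $ i\<bar> \<le> 1/2" for i
    by (rule order_trans[OF component_le_norm_cart])
  then show "x \<in> box_at z" by (simp add: mem_box_at)
qed

lemma compact_box_at [simp, intro]: "compact (box_at z)"
  unfolding box_at_def by (rule compact_translation) (rule compact_cbox)

lemma compact_boxes [simp, intro]: "finite A \<Longrightarrow> compact (boxes A)"
  unfolding boxes_def by (rule compact_UN) simp_all

text \<open>Change one coordinate of \<open>z\<close> into that of \<open>w\<close>. Membership in a
  box is a condition on each coordinate, so \<open>q\<close> stays in the new box. Either the new
  site has left \<open>A\<close>, and is a boundary site, or it differs from \<open>w\<close> in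
  fewer coordinates.\<close>

lemma outer_boundary_box:
  assumes "z \<in> A" "w \<notin> A" "q \<in> box_at z" "q \<in> box_at w"
  shows "\<exists>v\<in>outer_boundary A. q \<in> box_at v"
  using assms
proof (induction "card {i. z $ i \<noteq> w $ i}" arbitrary: z rule: less_induct)
  case less
  then have "z \<noteq> w" by auto
  then obtain i where i: "z $ i \<noteq> w $ i" by (auto simp: vec_eq_iff)
  define z' where "z' = (\<chi> k. if k = i then w $ i else z $ k)"
  have z': "z' $ k = (if k = i then w $ i else z $ k)" for k by (simp add: z'_def)
  have "\<bar>q $ i - real_of_int (z $ i)\<bar> \<le> 1/2" "\<bar>q $ i - real_of_int (w $ i)\<bar> \<le> 1/2"
    using less.prems(3,4) by (simp_all add: mem_box_at)
  then have "\<bar>w $ i - z $ i\<bar> = 1" using i by linarith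
  then have nb: "neighbours z' z" unfolding neighbours_iff by (intro exI[of _ i]) (simp add: z')
  have q: "q \<in> box_at z'" using less.prems(3,4) by (auto simp: mem_box_at z')
  show ?case
  proof (cases "z' \<in> A")
    case True
    have "{k. z' $ k \<noteq> w $ k} \<subset> {k. z $ k \<noteq> w $ k}" using i by (auto simp: z')
    then have "card {k. z' $ k \<noteq> w $ k} < card {k. z $ k \<noteq> w $ k}" by (intro psubset_card_mono) auto
    then show ?thesis using less.hyps True less.prems(2) q less.prems(4) by blast
  next
    case False
    then show ?thesis using nb less.prems(1) q by (auto simp: outer_boundary_def)
  qed
qed

lemma mem_box_at_round: "x \<in> box_at (\<chi> i. round (x $ i))"
proof -
  have "\<bar>x $ i - of_int (round (x $ i))\<bar> \<le> 1/2" for i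
    using of_int_round_abs_le[of "x $ i"] by (simp only: abs_minus_commute)
  then show ?thesis by (simp add: mem_box_at)
qed

text \<open>A line leaves the boxes of a finite set at a point that also lies in the box of a site
  outside the set; flipping coordinates one at a time then reaches a boundary site whose box
  contains this point, even if the two boxes share only a corner.\<close>

lemma line_hits_outer_boundary:
  fixes A :: "(int^'n) set"
  assumes A: "finite A" and L: "L \<in> lines" "L \<inter> boxes A \<noteq> {}"
  shows "L \<inter> boxes (outer_boundary A) \<noteq> {}"
proof -
  obtain p where p: "p \<in> L" "p \<in> boxes A" using L(2) by auto
  obtain u where u: "norm u = 1" "L = line_through p u" using lines_obtain_direction[OF L(1) p(1)] .
  define T where "T = (\<lambda>t. p + t *\<^sub>R u) -` boxes A"
  have "0 \<in> T" using p(2) by (simp add: T_def)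
  moreover have "closed T" unfolding T_def
    by (intro closed_vimage continuous_intros compact_imp_closed compact_boxes A)
  moreover have "bdd_above T"
  proof -
    obtain B where B: "\<And>x. x \<in> boxes A \<Longrightarrow> norm x \<le> B"
      using compact_imp_bounded[OF compact_boxes[OF A]] by (auto simp: bounded_iff)
    have "t \<le> B + norm p" if "t \<in> T" for t
    proof -
      have "norm (t *\<^sub>R u) \<le> norm (p + t *\<^sub>R u) + norm p"
        using norm_triangle_ineq4[of "p + t *\<^sub>R u" p] by simp
      then show ?thesis using B[of "p + t *\<^sub>R u"] that u(1) by (simp add: T_def)
    qed
    then show ?thesis by (auto simp: bdd_above_def)
  qed
  ultimately have s: "Sup T \<in> T" by (intro closed_contains_Sup) auto
  \<comment> \<open>The last parameter at which the line is inside the boxes; \<open>q\<close> is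
    the exit point.\<close>
  define s where "s = Sup T"
  define q where "q = p + s *\<^sub>R u"
  \<comment> \<open>The sites outside \<open>A\<close> near \<open>q\<close>. Restricting to
    finitely many makes the union of their boxes closed, so that if \<open>q\<close> were not in it,
    a whole neighbourhood of \<open>q\<close> would avoid it.\<close>
  define W where "W = {w. w \<notin> A \<and> (\<forall>i. \<bar>real_of_int (w $ i) - q $ i\<bar> \<le> 2)}"
  have "finite W"
  proof (rule finite_subset)
    show "finite {w :: int^'n. \<forall>i. w $ i \<in> {\<lfloor>q $ i\<rfloor> - 2..\<lfloor>q $ i\<rfloor> + 3}}"
      by (rule finite_vec_components) simp
    show "W \<subseteq> {w. \<forall>i. w $ i \<in> {\<lfloor>q $ i\<rfloor> - 2..\<lfloor>q $ i\<rfloor> + 3}}"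
    proof clarify
      fix w i assume "w \<in> W"
      then have "\<bar>real_of_int (w $ i) - q $ i\<bar> \<le> 2" by (simp add: W_def)
      then have "\<lfloor>q $ i\<rfloor> - 2 \<le> w $ i" "w $ i \<le> \<lfloor>q $ i\<rfloor> + 3" by linarith+
      then show "w $ i \<in> {\<lfloor>q $ i\<rfloor> - 2..\<lfloor>q $ i\<rfloor> + 3}" by simp
    qed
  qed
  have "q \<in> boxes W"
  proof (rule ccontr)
    assume "q \<notin> boxes W"
    then have "q \<in> - boxes W" by simp
    moreover have "open (- boxes W)"
      by (rule open_Compl[OF compact_imp_closed[OF compact_boxes[OF \<open>finite W\<close>]]])
    ultimately obtain d where d: "d > 0" "ball q d \<subseteq> - boxes W"
      using openE by blast
    \<comment> \<open>A point just beyond the exit. As \<open>h \<le> 1\<close>, rounding it gives a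
      site within 3/2 of \<open>q\<close> in each coordinate, inside the tolerance 2 of
      \<open>W\<close>.\<close>
    define h where "h = min (d / 2) 1"
    have h: "0 < h" "h < d" "h \<le> 1" using d(1) by (auto simp: h_def)
    define x where "x = p + (s + h) *\<^sub>R u"
    have xq: "x - q = h *\<^sub>R u" by (simp add: x_def q_def algebra_simps)
    have "s + h \<notin> T"
    proof
      assume "s + h \<in> T"
      then have "s + h \<le> s" unfolding s_def by (rule cSup_upper) (rule \<open>bdd_above T\<close>)
      then show False using h(1) by simp
    qed
    then have "x \<notin> boxes A" by (simp add: T_def x_def)
    define w where "w = (\<chi> i. round (x $ i))"
    have xw: "x \<in> box_at w" unfolding w_def by (rule mem_box_at_round)
    have "w \<notin> A" using \<open>x \<notin> boxes A\<close> xw by (auto simp: boxes_def)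
    moreover have "\<bar>real_of_int (w $ i) - q $ i\<bar> \<le> 2" for i
    proof -
      have "\<bar>x $ i - real_of_int (w $ i)\<bar> \<le> 1/2" using xw by (simp add: mem_box_at)
      moreover have "\<bar>x $ i - q $ i\<bar> \<le> 1"
      proof -
        have "norm (x - q) \<le> 1" unfolding xq using h u(1) by simp
        then show ?thesis using component_le_norm_cart[of "x - q" i] by simp
      qed
      ultimately show ?thesis by linarith
    qed
    ultimately have "w \<in> W" by (simp add: W_def)
    then have "x \<in> boxes W" using xw by (auto simp: boxes_def)
    moreover have "dist x q < d" unfolding dist_norm xq using h u(1) by simp
    then have "x \<in> ball q d" by (simp add: dist_commute)
    ultimately show False using d(2) by auto
  qed
  then obtain w where w: "w \<notin> A" "q \<in> box_at w" by (auto simp: boxes_def W_def)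
  have "q \<in> boxes A" using s by (simp add: T_def q_def s_def)
  then obtain z where z: "z \<in> A" "q \<in> box_at z" by (auto simp: boxes_def)
  obtain v where "v \<in> outer_boundary A" "q \<in> box_at v"
    using outer_boundary_box[OF z(1) w(1) z(2) w(2)] by auto
  moreover have "q \<in> L" by (auto simp: u(2) line_through_def q_def)
  ultimately show ?thesis by (auto simp: boxes_def)
qed

section \<open>Lines crossing a segment in the plane\<close>

text \<open>In the plane, a line that misses all boxes has the whole cluster on one side.\<close>

lemma planar_line_hits_cluster:
  fixes A :: "(int^'n) set"
  assumes two: "(UNIV :: 'n set) = {i, j}" "i \<noteq> j"
    and A: "cluster A" "x \<in> A"
    and q: "q \<in> closed_segment 0 (real_vec x)" "q \<in> L" and L: "L \<in> lines"
  shows "L \<inter> boxes A \<noteq> {}"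
proof
  assume empty: "L \<inter> boxes A = {}"
  obtain u where u: "norm u = 1" "L = line_through q u" using lines_obtain_direction[OF L q(2)] .
  \<comment> \<open>The direction \<open>u\<close> turned by a right angle. Hence \<open>f\<close>
    is the signed distance to the line, and \<open>zero\<close> says that it vanishes only
    there.\<close>
  define a where "a = axis i (- (u $ j)) + axis j (u $ i)"
  define f where "f p = a \<bullet> p - a \<bullet> q" for p
  have inner_ij: "v \<bullet> w = v $ i * w $ i + v $ j * w $ j" for v w :: "real^'n"
    using two(2) by (simp add: inner_vec_def two(1))
  have a: "a $ i = - (u $ j)" "a $ j = u $ i" using two(2) by (simp_all add: a_def axis_def)
  have zero: "p \<in> L" if "f p = 0" for p
  proof -
    let ?d = "p - q"
    have e: "?d $ j * u $ i = ?d $ i * u $ j"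
      using that by (simp add: f_def inner_ij a algebra_simps)
    have n: "u $ i * u $ i + u $ j * u $ j = 1" using u(1) by (simp add: norm_eq_1 inner_ij)
    have "(?d \<bullet> u) * u $ i = ?d $ i * (u $ i * u $ i) + (?d $ j * u $ i) * u $ j"
      by (simp add: inner_ij algebra_simps)
    also have "\<dots> = ?d $ i * (u $ i * u $ i + u $ j * u $ j)" unfolding e by (simp add: algebra_simps)
    finally have 1: "?d $ i = (?d \<bullet> u) * u $ i" using n by simp
    have "(?d \<bullet> u) * u $ j = (?d $ i * u $ j) * u $ i + ?d $ j * (u $ j * u $ j)"
      by (simp add: inner_ij algebra_simps)
    also have "\<dots> = ?d $ j * (u $ i * u $ i + u $ j * u $ j)" unfolding e[symmetric] by (simp add: algebra_simps)
    finally have 2: "?d $ j = (?d \<bullet> u) * u $ j" using n by simp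
    have "?d $ k = (?d \<bullet> u) * u $ k" for k
    proof -
      have "k \<in> {i, j}" by (simp flip: two(1))
      then show ?thesis using 1 2 by blast
    qed
    then have "?d = (?d \<bullet> u) *\<^sub>R u" by (simp add: vec_eq_iff)
    then show ?thesis using mem_line_through[OF u(1)] u(2) by blast
  qed
  have affine: "f ((1 - t) *\<^sub>R p + t *\<^sub>R p') = (1 - t) * f p + t * f p'" for t p p'
    by (simp add: f_def inner_add_right algebra_simps)
  have nz: "f p \<noteq> 0" if "p \<in> boxes A" for p using zero that empty by blast
  have centre: "real_vec z \<in> boxes A" if "z \<in> A" for z
  proof -
    have "real_vec z \<in> box_at z" by (simp add: mem_box_at)
    then show ?thesis using that by (auto simp: boxes_def)
  qed
  \<comment> \<open>If neighbours lay on opposite sides, \<open>f\<close> would vanish on the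
    segment joining them. Each point of it is within 1/2 of one of the two centres in every
    coordinate, hence in one of their boxes, which the line misses.\<close>
  have opposite: "\<not> (f (real_vec z) < 0 \<and> 0 < f (real_vec w))"
    if zw: "z \<in> A" "w \<in> A" "neighbours z w" for z w
  proof
    assume s: "f (real_vec z) < 0 \<and> 0 < f (real_vec w)"
    define t where "t = f (real_vec z) / (f (real_vec z) - f (real_vec w))"
    have t: "0 \<le> t" "t \<le> 1" using s by (auto simp: t_def divide_simps)
    define p where "p = (1 - t) *\<^sub>R real_vec z + t *\<^sub>R real_vec w"
    have ne: "f (real_vec z) - f (real_vec w) \<noteq> 0" using s by simp
    have "f p = f (real_vec z) - t * (f (real_vec z) - f (real_vec w))"
      unfolding p_def affine by (simp add: algebra_simps)
    then have "f p = 0" using ne by (simp add: t_def)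
    have close: "\<bar>real_of_int (w $ k) - real_of_int (z $ k)\<bar> \<le> 1" for k
    proof -
      obtain l where "\<bar>z $ l - w $ l\<bar> = 1" "\<And>j. j \<noteq> l \<Longrightarrow> z $ j = w $ j"
        using zw(3) by (auto simp: neighbours_iff)
      then have "\<bar>w $ k - z $ k\<bar> \<le> 1" by (cases "k = l") auto
      then show ?thesis by linarith
    qed
    have pz: "\<bar>p $ k - real_of_int (z $ k)\<bar> \<le> t" for k
    proof -
      have "p $ k - real_of_int (z $ k) = t * (real_of_int (w $ k) - real_of_int (z $ k))"
        by (simp add: p_def algebra_simps)
      then show ?thesis using close[of k] t(1) by (simp add: abs_mult mult_left_le)
    qed
    have pw: "\<bar>p $ k - real_of_int (w $ k)\<bar> \<le> 1 - t" for k
    proof -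
      have "p $ k - real_of_int (w $ k) = - ((1 - t) * (real_of_int (w $ k) - real_of_int (z $ k)))"
        by (simp add: p_def algebra_simps)
      then show ?thesis using close[of k] t(2) by (simp add: abs_mult mult_left_le)
    qed
    have "p \<in> box_at z \<or> p \<in> box_at w"
    proof (cases "t \<le> 1/2")
      case True
      then have "p \<in> box_at z" unfolding mem_box_at using pz order_trans by blast
      then show ?thesis ..
    next
      case False
      then have "1 - t \<le> 1/2" by simp
      then have "p \<in> box_at w" unfolding mem_box_at using pw order_trans by blast
      then show ?thesis ..
    qed
    then have "p \<in> boxes A" using zw by (auto simp: boxes_def)
    then show False using nz \<open>f p = 0\<close> by blast
  qed
  have same: "(0 < f (real_vec x)) = (0 < f (real_vec 0))"
  proof (rule cluster_invariant[OF A(1) _ A(2)])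
    fix z w assume zw: "z \<in> A" "w \<in> A" "neighbours z w"
    have "f (real_vec z) \<noteq> 0" "f (real_vec w) \<noteq> 0" using nz centre zw by blast+
    moreover have "neighbours w z" using zw(3) neighbours_sym by blast
    ultimately show "(0 < f (real_vec z)) = (0 < f (real_vec w))"
      using opposite[OF zw] opposite[OF zw(2,1)] by linarith
  qed
  have fx: "f (real_vec x) \<noteq> 0" "f (real_vec 0) \<noteq> 0" using nz centre A cluster_origin by blast+
  obtain t where t: "0 \<le> t" "t \<le> 1" "q = (1 - t) *\<^sub>R real_vec 0 + t *\<^sub>R real_vec x"
    using q(1) by (auto simp: in_segment)
  have "f q = 0" by (simp add: f_def)
  then have 0: "(1 - t) * f (real_vec 0) + t * f (real_vec x) = 0"
    using affine[of t "real_vec 0" "real_vec x"] t(3) by simp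
  \<comment> \<open>Since \<open>q\<close> lies on the line and on the segment, 0 is a convex
    combination of the values of \<open>f\<close> at 0 and at \<open>x\<close>, which have the same
    strict sign.\<close>
  have convex: "0 < (1 - t) * b + t * c" if "0 < b" "0 < c" for b c :: real
  proof (cases "t = 0")
    case False
    then have "0 < t * c" "0 \<le> (1 - t) * b" using that t by auto
    then show ?thesis by linarith
  qed (use that in simp)
  show False
  proof (cases "0 < f (real_vec x)")
    case True
    then show False using convex[of "f (real_vec 0)" "f (real_vec x)"] same 0 by simp
  next
    case False
    then have "0 < - f (real_vec x)" "0 < - f (real_vec 0)" using same fx by auto
    then show False using convex[of "- f (real_vec 0)" "- f (real_vec x)"] 0 by simp
  qed
qed

text \<open>The carrier line is removed because it meets all such segments at once; any other line
  meets it in at most one point. Length 1/2 lets segments one unit apart be disjoint, while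
  half-integer shifts still cover the carrier.\<close>

definition transversals :: "real^'n \<Rightarrow> real \<Rightarrow> (real^'n) set set" where
  "transversals e t = hitting_lines (closed_segment (t *\<^sub>R e) ((t + 1/2) *\<^sub>R e)) - {line_through 0 e}"

lemma transversals_disjoint:
  assumes e: "norm e = 1" and s: "s + 1 \<le> t"
  shows "transversals e s \<inter> transversals e t = {}"
proof (rule ccontr)
  assume "transversals e s \<inter> transversals e t \<noteq> {}"
  then obtain L where L: "L \<in> transversals e s" "L \<in> transversals e t" by blast
  have seg: "\<exists>b. r \<le> b \<and> b \<le> r + 1/2 \<and> b *\<^sub>R e \<in> L" if "L \<in> transversals e r" for r
  proof -
    obtain p where p: "p \<in> L" "p \<in> closed_segment (r *\<^sub>R e) ((r + 1/2) *\<^sub>R e)"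
      using \<open>L \<in> transversals e r\<close> by (auto simp: transversals_def hitting_lines_def)
    then obtain h where "0 \<le> h" "h \<le> 1" "p = (1 - h) *\<^sub>R (r *\<^sub>R e) + h *\<^sub>R ((r + 1/2) *\<^sub>R e)"
      by (auto simp: in_segment)
    then have "p = (r + h / 2) *\<^sub>R e" "0 \<le> h" "h \<le> 1" by (simp_all add: algebra_simps)
    then show ?thesis using p(1) by (intro exI[of _ "r + h / 2"]) auto
  qed
  obtain b c where bc: "b \<le> s + 1/2" "t \<le> c" "b *\<^sub>R e \<in> L" "c *\<^sub>R e \<in> L"
    using seg[OF L(1)] seg[OF L(2)] by blast
  have bc': "c - b \<noteq> 0" using bc s by linarith
  have lin: "L \<in> lines" "L \<noteq> line_through 0 e" using L(1) by (auto simp: transversals_def hitting_lines_def)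
  have aff: "affine L" using lin(1) by (simp add: lines_def)
  have "line_through 0 e \<subseteq> L"
  proof
    fix y assume "y \<in> line_through 0 e"
    then obtain r where y: "y = r *\<^sub>R e" by (auto simp: line_through_def)
    define h where "h = (r - b) / (c - b)"
    have "h * (c - b) = r - b" using bc' by (simp add: h_def)
    then have "y = ((1 - h) * b + h * c) *\<^sub>R e" by (simp add: y algebra_simps)
    then have "y = (1 - h) *\<^sub>R (b *\<^sub>R e) + h *\<^sub>R (c *\<^sub>R e)" by (simp add: scaleR_add_left)
    then show "y \<in> L" using mem_affine[OF aff bc(3,4), of "1 - h" h] by simp
  qed
  moreover have "line_through 0 e \<in> lines" by (rule line_through_in_lines) (use e in auto)
  ultimately have "line_through 0 e = L"
    using affine_dim_equal[of "line_through 0 e" L] lin by (auto simp: lines_def line_through_def)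
  then show False using lin by simp
qed

text \<open>Makes the measure independent of both the direction and the position of the
  segment.\<close>

lemma transversals_motion:
  fixes f :: "real^'n \<Rightarrow> real^'n"
  assumes f: "orthogonal_transformation f"
  shows "(`) (\<lambda>x. t *\<^sub>R f e + f x) ` transversals e 0 = transversals (f e) t"
proof -
  let ?g = "\<lambda>x. t *\<^sub>R f e + f x"
  have l: "linear f" using f by (simp add: orthogonal_transformation)
  have g: "euclidean_motion ?g" unfolding euclidean_motion_def
    by (intro exI[of _ "t *\<^sub>R f e"] exI[of _ f]) (simp add: f)
  have inj: "inj ((`) ?g)"
    by (rule inj_on_image) (simp add: bij_is_inj[OF euclidean_motion_inverse(1)[OF g]])
  have "?g ` closed_segment (0 *\<^sub>R e) ((0 + 1/2) *\<^sub>R e) = (+) (t *\<^sub>R f e) ` f ` closed_segment (0 *\<^sub>R e) ((0 + 1/2) *\<^sub>R e)"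
    by (simp add: image_image)
  also have "\<dots> = closed_segment (t *\<^sub>R f e) ((t + 1/2) *\<^sub>R f e)"
    unfolding closed_segment_linear_image[OF l, symmetric] closed_segment_translation[symmetric]
    by (simp add: linear_0[OF l] linear_cmul[OF l] algebra_simps)
  finally have 1: "?g ` closed_segment (0 *\<^sub>R e) ((0 + 1/2) *\<^sub>R e) = closed_segment (t *\<^sub>R f e) ((t + 1/2) *\<^sub>R f e)" .
  have "?g ` line_through 0 e = line_through (t *\<^sub>R f e) (f e)"
    using line_through_motion[OF f, of "t *\<^sub>R f e" 0 e] by (simp add: linear_0[OF l])
  also have "\<dots> = line_through 0 (f e)"
  proof (intro set_eqI iffI)
    fix y assume "y \<in> line_through (t *\<^sub>R f e) (f e)"
    then obtain s where "y = t *\<^sub>R f e + s *\<^sub>R f e" by (auto simp: line_through_def)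
    then show "y \<in> line_through 0 (f e)"
      unfolding line_through_def by (intro range_eqI[of _ _ "t + s"]) (simp add: algebra_simps)
  next
    fix y assume "y \<in> line_through 0 (f e)"
    then obtain s where "y = s *\<^sub>R f e" by (auto simp: line_through_def)
    then show "y \<in> line_through (t *\<^sub>R f e) (f e)"
      unfolding line_through_def by (intro range_eqI[of _ _ "s - t"]) (simp add: algebra_simps)
  qed
  finally have 2: "?g ` line_through 0 e = line_through 0 (f e)" .
  show ?thesis
    unfolding transversals_def image_set_diff[OF inj] hitting_lines_motion[OF g] 1 by (simp add: 2)
qed

text \<open>A planar line not parallel to axis \<open>i\<close> crosses it in exactly one point,
  which lies in one of the half-unit segments tiling the axis.\<close>

lemma transversals_axis_cover:
  fixes i j :: "'n::finite"
  assumes two: "(UNIV :: 'n set) = {i, j}" "i \<noteq> j" and uj: "u $ j \<noteq> 0" "L \<in> lines" "L = line_through x u"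
  shows "\<exists>n::int. L \<in> transversals (axis i 1) (of_int n / 2)"
proof -
  \<comment> \<open>The crossing point, obtained by solving for a vanishing \<open>j\<close>-th
    coordinate.\<close>
  define p where "p = x - (x $ j / u $ j) *\<^sub>R u"
  define b where "b = p $ i"
  have pj: "p $ j = 0" using uj(1) by (simp add: p_def)
  have "p $ k = (b *\<^sub>R axis i 1) $ k" for k
  proof -
    have "k \<in> {i, j}" by (simp flip: two(1))
    then show ?thesis using pj two(2) by (auto simp: b_def axis_def)
  qed
  then have p: "p = b *\<^sub>R axis i 1" by (simp add: vec_eq_iff)
  have pL: "p \<in> L" unfolding uj(3) line_through_def
    by (rule range_eqI[of _ _ "- (x $ j / u $ j)"]) (simp add: p_def)
  have "p + u \<in> L" unfolding uj(3) line_through_def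
    by (rule range_eqI[of _ _ "1 - (x $ j / u $ j)"]) (simp add: p_def algebra_simps)
  moreover have "p + u \<notin> line_through 0 (axis i 1)"
  proof
    assume "p + u \<in> line_through 0 (axis i 1)"
    then obtain t where "p + u = t *\<^sub>R axis i 1" by (auto simp: line_through_def)
    then have "(p + u) $ j = (t *\<^sub>R axis i 1) $ j" by simp
    then show False using pj uj(1) two(2) by (simp add: axis_def)
  qed
  ultimately have ne: "L \<noteq> line_through 0 (axis i 1)" by blast
  define n where "n = \<lfloor>2 * b\<rfloor>"
  have n: "of_int n / 2 \<le> b" "b \<le> of_int n / 2 + 1/2" unfolding n_def by linarith+
  define h where "h = 2 * b - of_int n"
  have "p \<in> closed_segment ((of_int n / 2) *\<^sub>R axis i 1) ((of_int n / 2 + 1/2) *\<^sub>R axis i 1)"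
    unfolding in_segment
  proof (intro exI conjI)
    show "0 \<le> h" "h \<le> 1" using n by (auto simp: h_def)
    have "(1 - h) * (of_int n / 2) + h * (of_int n / 2 + 1/2) = b" by (simp add: h_def field_simps)
    then show "p = (1 - h) *\<^sub>R ((of_int n / 2) *\<^sub>R axis i 1) + h *\<^sub>R ((of_int n / 2 + 1/2) *\<^sub>R axis i 1)"
      unfolding p by (simp only: scaleR_scaleR scaleR_add_left[symmetric])
  qed
  then show ?thesis using pL ne uj(2) by (auto simp: transversals_def hitting_lines_def)
qed

context line_measure
begin

lemma transversals_sets [simp, intro]:
  assumes "norm e = 1"
  shows "transversals e t \<in> fmeasurable \<mu>"
proof -
  have "e \<noteq> 0" using assms by auto
  \<comment> \<open>Measurability of the removed singleton: two distinct points determine the line,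
    and hitting a point is a measurable condition.\<close>
  have "{line_through 0 e} = hitting_lines {0} \<inter> hitting_lines {e}"
  proof (intro equalityI subsetI)
    fix L assume "L \<in> {line_through 0 e}"
    moreover have "0 \<in> line_through 0 e" "e \<in> line_through 0 e"
      unfolding line_through_def by (rule range_eqI[of _ _ 0], simp) (rule range_eqI[of _ _ 1], simp)
    ultimately show "L \<in> hitting_lines {0} \<inter> hitting_lines {e}"
      using line_through_in_lines[OF \<open>e \<noteq> 0\<close>, of 0] by (auto simp: hitting_lines_def)
  next
    fix L assume "L \<in> hitting_lines {0} \<inter> hitting_lines {e}"
    then have L: "L \<in> lines" "0 \<in> L" "e \<in> L" by (auto simp: hitting_lines_def)
    have "line_through 0 e \<subseteq> L"
      unfolding line_through_eq_affine_hull using L by (intro hull_minimal) (auto simp: lines_def)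
    then have "line_through 0 e = L"
      using affine_dim_equal[of "line_through 0 e" L] L(1) line_through_in_lines[OF \<open>e \<noteq> 0\<close>, of 0]
      by (auto simp: lines_def line_through_def)
    then show "L \<in> {line_through 0 e}" by simp
  qed
  then have "{line_through 0 e} \<in> sets \<mu>" by (simp add: sets.Int)
  then show ?thesis unfolding transversals_def by (intro fmeasurable_Diff hitting_fmeasurable compact_segment)
qed

lemma emeasure_transversals:
  assumes "norm e = 1" "norm e' = 1"
  shows "emeasure \<mu> (transversals e t) = emeasure \<mu> (transversals e' 0)"
proof -
  obtain f where f: "orthogonal_transformation f" "f e' = e"
    using orthogonal_transformation_exists_1[OF assms(2,1)] by blast
  have g: "euclidean_motion (\<lambda>x. t *\<^sub>R f e' + f x)" unfolding euclidean_motion_def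
    by (intro exI[of _ "t *\<^sub>R f e'"] exI[of _ f]) (simp add: f)
  show ?thesis
    using emeasure_motion[OF g, of "transversals e' 0"] transversals_motion[OF f(1), of t e'] f(2) assms(2)
    by (simp add: fmeasurableD)
qed

text \<open>Otherwise all half-unit segments on both axes would have null transversals by
  invariance. Every planar line crosses one of the axes transversally, so the lines hitting the unit
  ball would be null, against the normalization.\<close>

lemma measure_transversals_pos:
  assumes two: "(UNIV :: 'n set) = {i, j}" "i \<noteq> j" and e: "norm e = 1"
  shows "0 < measure \<mu> (transversals e 0)"
proof (rule ccontr)
  assume "\<not> 0 < measure \<mu> (transversals e 0)"
  then have "measure \<mu> (transversals e 0) = 0" by (simp add: zero_less_measure_iff)
  then have z: "emeasure \<mu> (transversals e 0) = 0"
    by (subst emeasure_eq_ennreal_measure) (use fmeasurableD2[OF transversals_sets[OF e]] in auto)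
  have null: "transversals (axis k 1) t \<in> null_sets \<mu>" for k t
  proof (rule null_setsI)
    show "emeasure \<mu> (transversals (axis k 1) t) = 0"
      using emeasure_transversals[OF norm_axis_1 e] z by simp
    show "transversals (axis k 1) t \<in> sets \<mu>"
      by (rule fmeasurableD[OF transversals_sets[OF norm_axis_1]])
  qed
  have "hitting_lines (cball 0 1) \<subseteq> (\<Union>n::int. transversals (axis i 1) (of_int n / 2)) \<union> (\<Union>n::int. transversals (axis j 1) (of_int n / 2))"
  proof
    fix L :: "(real^'n) set" assume "L \<in> hitting_lines (cball 0 1)"
    then have L: "L \<in> lines" by (simp add: hitting_lines_def)
    obtain x u where u: "norm u = 1" "L = line_through x u" using lines_obtain[OF L] .
    have "u $ i \<noteq> 0 \<or> u $ j \<noteq> 0"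
    proof (rule ccontr)
      assume "\<not> ?thesis"
      then have z: "u $ i = 0" "u $ j = 0" by auto
      have "u $ k = 0" for k
      proof -
        have "k \<in> {i, j}" by (simp flip: two(1))
        then show ?thesis using z by auto
      qed
      then have "u = 0" by (simp add: vec_eq_iff)
      then show False using u(1) by simp
    qed
    moreover have "(UNIV :: 'n set) = {j, i}" using two(1) by auto
    ultimately show "L \<in> (\<Union>n::int. transversals (axis i 1) (of_int n / 2)) \<union> (\<Union>n::int. transversals (axis j 1) (of_int n / 2))"
      using transversals_axis_cover[OF two _ L u(2)] transversals_axis_cover[of j i, OF _ two(2)[symmetric] _ L u(2)] by blast
  qed
  moreover have "(\<Union>n::int. transversals (axis i 1) (of_int n / 2)) \<union> (\<Union>n::int. transversals (axis j 1) (of_int n / 2)) \<in> null_sets \<mu>"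
    by (intro null_sets.Un null_sets_UN' null) auto
  ultimately have "hitting_lines (cball 0 1) \<in> null_sets \<mu>"
    by (rule null_sets_subset[rotated 2]) (rule hitting_sets[OF compact_cball])
  then show False using emeasure_unit_ball_pos by (simp add: null_sets_def)
qed

text \<open>About \<open>norm x\<close> unit-spaced segments fit between 0 and \<open>x\<close>.
  Their transversals are disjoint, have equal positive measure, and all meet the boxes of the
  cluster, hence those of its boundary.\<close>

lemma measure_hitting_outer_boundary_plane:
  assumes "CARD('n) = 2"
  shows "\<exists>c>0. \<forall>A x. cluster A \<longrightarrow> x \<in> A \<longrightarrow> 1 \<le> norm (real_vec x :: real^'n) \<longrightarrow>
    c * norm (real_vec x :: real^'n) \<le> measure \<mu> (hitting_lines (boxes (outer_boundary A)))"
proof -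
  obtain i j :: 'n where two: "UNIV = {i, j}" "i \<noteq> j" using assms by (auto simp: card_2_iff)
  define h where "h = measure \<mu> (transversals (axis i 1) 0)"
  have "h > 0" unfolding h_def by (rule measure_transversals_pos[OF two]) (simp add: norm_axis_1)
  moreover have "(h / 2) * norm (real_vec x) \<le> measure \<mu> (hitting_lines (boxes (outer_boundary A)))"
    if A: "cluster A" "x \<in> A" and x: "1 \<le> norm (real_vec x :: real^'n)" for A :: "(int^'n) set" and x
  proof -
    define r where "r = norm (real_vec x)"
    define e where "e = (1 / r) *\<^sub>R real_vec x"
    have r: "1 \<le> r" using x by (simp add: r_def)
    have e: "norm e = 1" "real_vec x = r *\<^sub>R e" using r by (auto simp: e_def r_def)
    \<comment> \<open>Rounding down costs at most a factor 2 since \<open>r \<ge> 1\<close>. For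
      \<open>k < m\<close> the segment ends at \<open>k + 1/2\<close>, before
      \<open>x\<close>.\<close>
    define m where "m = nat \<lfloor>r\<rfloor>"
    have m: "real m \<le> r" "r / 2 \<le> real m"
    proof -
      have "real m = of_int \<lfloor>r\<rfloor>" "1 \<le> \<lfloor>r\<rfloor>" using r by (simp_all add: m_def)
      then show "real m \<le> r" "r / 2 \<le> real m" by linarith+
    qed
    have disj: "disjoint_family_on (\<lambda>k. transversals e (real k)) {..<m}"
      unfolding disjoint_family_on_def
    proof (intro ballI impI)
      fix k l :: nat assume "k \<noteq> l"
      then consider "k < l" | "l < k" by linarith
      then show "transversals e (real k) \<inter> transversals e (real l) = {}"
      proof cases
        case 1
        then show ?thesis using transversals_disjoint[OF e(1), of "real k" "real l"] by simp
      next
        case 2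
        then show ?thesis using transversals_disjoint[OF e(1), of "real l" "real k"] by auto
      qed
    qed
    have sub: "(\<Union>k<m. transversals e (real k)) \<subseteq> hitting_lines (boxes (outer_boundary A))"
    proof clarify
      fix k L assume k: "k < m" and L: "L \<in> transversals e (real k)"
      have lin: "L \<in> lines" using L by (simp add: transversals_def hitting_lines_def)
      have in_seg: "s *\<^sub>R e \<in> closed_segment 0 (real_vec x)" if "0 \<le> s" "s \<le> r" for s
        unfolding in_segment e(2) using that r by (intro exI[of _ "s / r"]) auto
      have "closed_segment (real k *\<^sub>R e) ((real k + 1/2) *\<^sub>R e) \<subseteq> closed_segment 0 (real_vec x)"
        using k m(1) by (intro closed_segment_subset in_seg convex_closed_segment) auto
      then obtain q where "q \<in> L" "q \<in> closed_segment 0 (real_vec x)"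
        using L by (auto simp: transversals_def hitting_lines_def)
      then have "L \<inter> boxes A \<noteq> {}" using planar_line_hits_cluster[OF two A] lin by blast
      then show "L \<in> hitting_lines (boxes (outer_boundary A))"
        using line_hits_outer_boundary[OF cluster_finite[OF A(1)] lin] lin by (simp add: hitting_lines_def)
    qed
    have "measure \<mu> (transversals e (real k)) = h" for k
      unfolding h_def measure_def using emeasure_transversals[OF e(1), of "axis i 1" "real k"] by (simp add: norm_axis_1)
    then have "real m * h = (\<Sum>k<m. measure \<mu> (transversals e (real k)))" by simp
    also have "\<dots> = measure \<mu> (\<Union>k<m. transversals e (real k))"
      using disj transversals_sets[OF e(1)]
      by (intro measure_finite_Union[symmetric]) (auto simp: fmeasurable_def less_top[symmetric])
    also have "\<dots> \<le> measure \<mu> (hitting_lines (boxes (outer_boundary A)))"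
      using sub transversals_sets[OF e(1)] cluster_finite[OF A(1)]
      by (intro measure_mono_fmeasurable hitting_fmeasurable compact_boxes finite_outer_boundary sets.finite_UN fmeasurableD) auto
    finally have "real m * h \<le> measure \<mu> (hitting_lines (boxes (outer_boundary A)))" .
    moreover have "r / 2 * h \<le> real m * h" using m(2) \<open>h > 0\<close> by (intro mult_right_mono) auto
    ultimately show ?thesis by (simp add: r_def mult.commute)
  qed
  ultimately show ?thesis by (intro exI[of _ "h / 2"]) auto
qed

end

section \<open>Spread of the ballistic measure\<close>

context line_measure
begin

text \<open>Some coordinate of \<open>x\<close> is large, and the cluster passes every level
  between. Boundary sites on the levels 0, 30, 60, ... supply linearly many separated balls inside
  boundary boxes.\<close>

lemma measure_hitting_outer_boundary_space:
  assumes card: "CARD('n) \<ge> 3"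
  shows "\<exists>c>0. \<forall>A x. cluster A \<longrightarrow> x \<in> A \<longrightarrow> 1 \<le> norm (real_vec x :: real^'n) \<longrightarrow>
    c * norm (real_vec x :: real^'n) \<le> measure \<mu> (hitting_lines (boxes (outer_boundary A)))"
proof -
  define b where "b = measure \<mu> (hitting_lines (cball 0 (1/2)))"
  have "b > 0" unfolding b_def by (rule measure_hitting_cball_pos) simp
  \<comment> \<open>There are at least \<open>r / (30 * CARD('n))\<close> levels, each contributing
    \<open>b / 2\<close>.\<close>
  define c where "c = b / (60 * real CARD('n))"
  have "c > 0" using \<open>b > 0\<close> by (simp add: c_def)
  moreover have "c * norm (real_vec x) \<le> measure \<mu> (hitting_lines (boxes (outer_boundary A)))"
    if A: "cluster A" "x \<in> A" and x: "1 \<le> norm (real_vec x :: real^'n)" for A :: "(int^'n) set" and x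
  proof -
    define r where "r = norm (real_vec x)"
    \<comment> \<open>By pigeonhole: the norm is at most the sum of the absolute
      coordinates.\<close>
    have "\<exists>i. r / real CARD('n) \<le> \<bar>real_of_int (x $ i)\<bar>"
    proof (rule ccontr)
      assume "\<not> ?thesis"
      then have "\<And>i. \<bar>real_vec x $ i\<bar> < r / real CARD('n)" by (simp add: not_le)
      then have "(\<Sum>i\<in>UNIV. \<bar>real_vec x $ i\<bar>) < (\<Sum>i\<in>(UNIV::'n set). r / real CARD('n))"
        by (intro sum_strict_mono) auto
      also have "\<dots> = r" by simp
      finally show False using norm_le_l1_cart[of "real_vec x"] by (simp add: r_def)
    qed
    then obtain i where i: "r / real CARD('n) \<le> \<bar>real_of_int (x $ i)\<bar>" ..
    have "\<exists>j. j \<noteq> i"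
    proof (rule ccontr)
      assume "\<not> ?thesis"
      then have u: "(UNIV :: 'n set) = {i}" by auto
      have "CARD('n) = card {i}" by (simp only: u)
      then show False using card by simp
    qed
    then obtain j where j: "j \<noteq> i" ..
    define X where "X = \<bar>x $ i\<bar>"
    \<comment> \<open>The summand 1 counts level 0. The sign in \<open>t\<close> directs the levels
      towards \<open>x\<close>.\<close>
    define m where "m = nat (X div 30) + 1"
    define t where "t k = sgn (x $ i) * (30 * int k)" for k
    have "0 < r" using x unfolding r_def by linarith
    then have "0 < r / real CARD('n)" by simp
    then have xi: "x $ i \<noteq> 0" using i by auto
    have ex: "\<exists>w\<in>outer_boundary A. w $ i = t k" if "k < m" for k
    proof -
      have X: "X \<ge> 0" by (simp add: X_def)
      have "k \<le> nat (X div 30)" using that by (simp add: m_def)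
      then have "int k \<le> X div 30" using X by (simp add: nat_le_iff pos_imp_zdiv_nonneg_iff le_nat_iff)
      then have le: "30 * int k \<le> X" by linarith
      have "0 \<le> t k \<and> t k \<le> x $ i \<or> x $ i \<le> t k \<and> t k \<le> 0"
      proof (cases "x $ i > 0")
        case True
        then show ?thesis using le by (simp add: t_def X_def)
      next
        case False
        then have "x $ i < 0" using xi by simp
        then show ?thesis using le by (simp add: t_def X_def)
      qed
      then obtain w where w: "w \<in> A" "w $ i = t k" using cluster_levels[OF A, of "t k" i] by blast
      obtain w' where "w' \<in> outer_boundary A" "w' $ i = w $ i"
        using outer_boundary_level[OF cluster_finite[OF A(1)] w(1) j] .
      then show ?thesis using w(2) by auto
    qed
    then obtain z where z: "\<And>k. k < m \<Longrightarrow> z k \<in> outer_boundary A" "\<And>k. k < m \<Longrightarrow> z k $ i = t k"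
      by metis
    have "real m * (b / 2) \<le> measure \<mu> (\<Union>k<m. hitting_lines (cball (real_vec (z k)) (1/2)))"
      unfolding b_def
    proof (rule measure_hitting_separated_ge[OF card])
      fix l k assume lk: "l < k" "k < m"
      have "\<bar>(real_vec (z l) - real_vec (z k)) $ i\<bar> = \<bar>real_of_int (t l - t k)\<bar>"
        using z lk by simp
      also have "t l - t k = - (sgn (x $ i) * (30 * int (k - l)))"
        using lk by (simp add: t_def algebra_simps)
      also have "\<bar>real_of_int (- (sgn (x $ i) * (30 * int (k - l))))\<bar> = 30 * real (k - l)"
        using xi by (auto simp: sgn_if)
      finally show "30 * real (k - l) \<le> dist (real_vec (z l)) (real_vec (z k))"
        unfolding dist_norm
        using component_le_norm_cart[of "real_vec (z l) - real_vec (z k)" i] by linarith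
    qed
    also have "\<dots> \<le> measure \<mu> (hitting_lines (boxes (outer_boundary A)))"
    proof (rule measure_mono_fmeasurable)
      show "(\<Union>k<m. hitting_lines (cball (real_vec (z k)) (1/2))) \<subseteq> hitting_lines (boxes (outer_boundary A))"
        unfolding hitting_lines_UN[symmetric]
        by (rule hitting_lines_mono) (use z(1) cball_subset_box_at in \<open>fastforce simp: boxes_def\<close>)
    qed (auto simp: finite_outer_boundary cluster_finite[OF A(1)])
    finally have *: "real m * (b / 2) \<le> measure \<mu> (hitting_lines (boxes (outer_boundary A)))" .
    have "X \<le> 30 * int m" by (simp add: m_def X_def) linarith
    then have "real_of_int X \<le> 30 * real m" by linarith
    then have "r / real CARD('n) \<le> 30 * real m" using i by (simp add: X_def)
    then have "r / real CARD('n) * (b / 60) \<le> 30 * real m * (b / 60)"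
      using \<open>b > 0\<close> by (intro mult_right_mono) auto
    then have "c * r \<le> real m * (b / 2)" by (simp add: c_def field_simps)
    with * show ?thesis by (simp add: r_def)
  qed
  ultimately show ?thesis by blast
qed

lemma measure_hitting_outer_boundary:
  assumes "CARD('n) \<ge> 2"
  shows "\<exists>c>0. \<forall>A x. cluster A \<longrightarrow> x \<in> A \<longrightarrow> 1 \<le> norm (real_vec x :: real^'n) \<longrightarrow>
    c * norm (real_vec x :: real^'n) \<le> measure \<mu> (hitting_lines (boxes (outer_boundary A)))"
proof (cases "CARD('n) = 2")
  case True
  then show ?thesis by (rule measure_hitting_outer_boundary_plane)
next
  case False
  then show ?thesis using assms by (intro measure_hitting_outer_boundary_space) simp
qed

lemma measure_hitting_box_at: "measure \<mu> (hitting_lines (box_at z)) = measure \<mu> (hitting_lines (box_at 0))"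
proof -
  have "box_at z = (+) (real_vec z) ` box_at 0" by (simp add: box_at_def image_image)
  then show ?thesis using measure_hitting_translation[OF compact_box_at] by simp
qed

end

section \<open>Upper bounds for the ballistic mass of a site\<close>

lemma ballistic_weight_eq_0:
  assumes "z \<notin> visited A L"
  shows "ballistic_weight v A z L = 0"
proof -
  have "visited A L \<noteq> {z}" using assms by blast
  then show ?thesis
    using assms by (simp add: ballistic_weight_def is_first_visited_def is_last_visited_def)
qed

lemma ballistic_measure_eq_0:
  assumes "z \<notin> A"
  shows "ballistic_measure \<mu> v A z = 0"
proof -
  have "ballistic_weight v A z = (\<lambda>L. 0)"
    by (rule ext, rule ballistic_weight_eq_0) (use assms in \<open>simp add: visited_def\<close>)
  then show ?thesis by (simp add: ballistic_measure_def)
qed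

text \<open>The weight is at most the indicator of hitting the box of \<open>z\<close>, so the mass
  is at most the conditional probability of that event.\<close>

lemma ballistic_measure_le:
  fixes \<mu> :: "(real^'n::{finite,linorder}) set measure"
  assumes "invariant_line_measure \<mu>" and A: "finite A"
    and pos: "0 < measure \<mu> (hitting_lines (boxes A))"
  shows "ballistic_measure \<mu> v A z \<le>
    measure \<mu> (hitting_lines (box_at 0)) / measure \<mu> (hitting_lines (boxes A))"
proof -
  interpret line_measure \<mu> by standard fact
  let ?H = "hitting_lines (boxes A)" and ?B = "hitting_lines (box_at z)"
  have H: "?H \<in> fmeasurable \<mu>" using A by auto
  have em: "emeasure \<mu> ?H \<noteq> 0" "emeasure \<mu> ?H \<noteq> \<infinity>"
    using pos fmeasurableD2[OF H] by (auto simp: measure_def)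
  have space: "space \<mu> = lines" using sets_eq_imp_space_eq[OF sets_eq] by (simp add: space_line_borel)
  interpret U: prob_space "uniform_measure \<mu> ?H" by (rule prob_space_uniform_measure[OF em])
  have B: "?B \<in> sets \<mu>" by auto
  have "ballistic_measure \<mu> v A z \<le> (LINT L | uniform_measure \<mu> ?H. indicat_real ?B L)"
    unfolding ballistic_measure_def
  \<comment> \<open>This rule asks for integrability of the dominating indicator only; a
    non-integrable weight would have integral 0 by convention, which respects the bound as
    well.\<close>
  proof (rule integral_mono')
    show "integrable (uniform_measure \<mu> ?H) (indicat_real ?B)"
      using B by (intro integrable_real_indicator) (auto simp: U.emeasure_finite less_top[symmetric])
    fix L assume "L \<in> space (uniform_measure \<mu> ?H)"
    then have L: "L \<in> lines" by (simp add: space)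
    show "ballistic_weight v A z L \<le> indicat_real ?B L"
    proof (cases "L \<in> ?B")
      case True
      then show ?thesis by (simp add: ballistic_weight_def)
    next
      case False
      then have "z \<notin> visited A L" using L by (auto simp: visited_def hitting_lines_def)
      then show ?thesis by (simp add: ballistic_weight_eq_0)
    qed
  qed auto
  also have "\<dots> = measure (uniform_measure \<mu> ?H) ?B"
    using B by simp
  also have "\<dots> = measure \<mu> (?H \<inter> ?B) / measure \<mu> ?H"
    by (rule measure_uniform_measure[OF em B])
  also have "\<dots> \<le> measure \<mu> ?B / measure \<mu> ?H"
    using H B by (intro divide_right_mono measure_mono_fmeasurable) (auto intro: fmeasurableD)
  finally show ?thesis by (simp only: measure_hitting_box_at[of z])
qed

lemma ballistic_measure_outer_boundary_le:
  fixes \<mu> :: "(real^'n::{finite,linorder}) set measure"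
  assumes "CARD('n) \<ge> 2" "invariant_line_measure \<mu>"
  obtains C where "C > 0"
    "\<And>(A :: (int^'n::_) set) x z v. cluster A \<Longrightarrow> x \<in> A \<Longrightarrow> 1 \<le> norm (real_vec x) \<Longrightarrow>
      ballistic_measure \<mu> v (outer_boundary A) z \<le> C / norm (real_vec x)"
proof -
  interpret line_measure \<mu> by standard fact
  obtain c where c: "c > 0" and le: "\<And>(A :: (int^'n::_) set) x. cluster A \<Longrightarrow> x \<in> A \<Longrightarrow> 1 \<le> norm (real_vec x :: real^'n::_) \<Longrightarrow>
    c * norm (real_vec x :: real^'n::_) \<le> measure \<mu> (hitting_lines (boxes (outer_boundary A)))"
    using measure_hitting_outer_boundary[OF assms(1)] by blast
  define b where "b = measure \<mu> (hitting_lines (box_at 0))"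
  have b: "b \<ge> 0" by (simp add: b_def)
  show thesis
  \<comment> \<open>Adding 1 to \<open>b\<close> yields positivity of the constant at once from
    \<open>b \<ge> 0\<close>.\<close>
  proof (rule that[of "(b + 1) / c"])
    show "(b + 1) / c > 0" using b c by simp
    fix A :: "(int^'n::_) set" and x z v assume A: "cluster A" "x \<in> A" "1 \<le> norm (real_vec x :: real^'n::_)"
    have pos: "0 < c * norm (real_vec x :: real^'n::_)" by (rule mult_pos_pos) (use c A(3) in linarith)+
    have "ballistic_measure \<mu> v (outer_boundary A) z \<le> b / measure \<mu> (hitting_lines (boxes (outer_boundary A)))"
      unfolding b_def using pos le[OF A]
      by (intro ballistic_measure_le assms finite_outer_boundary cluster_finite A(1)) simp
    also have "\<dots> \<le> (b + 1) / (c * norm (real_vec x :: real^'n::_))"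
      using b pos le[OF A] by (intro frac_le) auto
    finally show "ballistic_measure \<mu> v (outer_boundary A) z \<le> (b + 1) / c / norm (real_vec x)" by simp
  qed
qed

section \<open>Growth of the aggregate\<close>

text \<open>Replaces conditional expectation: the cluster has countably many possible values, so an
  inequality may be checked on each event that fixes the value. The splitting is countable
  additivity of the measure with density \<open>h\<close>.\<close>

lemma nn_integral_le_on_atoms:
  assumes X: "X \<in> measurable M (count_space I)" and I: "countable I"
    and f [measurable]: "f \<in> borel_measurable M" and g [measurable]: "g \<in> borel_measurable M"
    and le: "\<And>i. i \<in> I \<Longrightarrow>
      (\<integral>\<^sup>+\<omega>. f \<omega> * indicator {\<omega> \<in> space M. X \<omega> = i} \<omega> \<partial>M) \<le> (\<integral>\<^sup>+\<omega>. g \<omega> * indicator {\<omega> \<in> space M. X \<omega> = i} \<omega> \<partial>M)"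
  shows "(\<integral>\<^sup>+\<omega>. f \<omega> \<partial>M) \<le> (\<integral>\<^sup>+\<omega>. g \<omega> \<partial>M)"
proof -
  let ?S = "\<lambda>i. {\<omega> \<in> space M. X \<omega> = i}"
  have S: "?S i \<in> sets M" if "i \<in> I" for i
  proof -
    have "X -` {i} \<inter> space M \<in> sets M" by (rule measurable_sets[OF X]) (use that in simp)
    moreover have "?S i = X -` {i} \<inter> space M" by auto
    ultimately show ?thesis by (simp only:)
  qed
  have U: "(\<Union>i\<in>I. ?S i) = space M" using measurable_space[OF X] by auto
  have split: "(\<integral>\<^sup>+\<omega>. h \<omega> \<partial>M) = (\<integral>\<^sup>+i. (\<integral>\<^sup>+\<omega>. h \<omega> * indicator (?S i) \<omega> \<partial>M) \<partial>count_space I)"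
    if h: "h \<in> borel_measurable M" for h :: "'a \<Rightarrow> ennreal"
  proof -
    have "(\<integral>\<^sup>+\<omega>. h \<omega> \<partial>M) = (\<integral>\<^sup>+\<omega>. h \<omega> * indicator (space M) \<omega> \<partial>M)"
      by (intro nn_integral_cong) simp
    also have "\<dots> = emeasure (density M h) (space M)"
      by (rule emeasure_density[OF h sets.top, symmetric])
    also have "\<dots> = emeasure (density M h) (\<Union>i\<in>I. ?S i)" by (simp only: U)
    also have "\<dots> = (\<integral>\<^sup>+i. emeasure (density M h) (?S i) \<partial>count_space I)"
      by (rule emeasure_UN_countable) (use S I in \<open>auto simp: disjoint_family_on_def\<close>)
    also have "\<dots> = (\<integral>\<^sup>+i. (\<integral>\<^sup>+\<omega>. h \<omega> * indicator (?S i) \<omega> \<partial>M) \<partial>count_space I)"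
      by (intro nn_integral_cong emeasure_density[OF h] S) simp
    finally show ?thesis .
  qed
  show ?thesis unfolding split[OF f] split[OF g]
    by (rule nn_integral_mono) (use le in simp)
qed

lemma countable_finite_lattice_sets: "countable {A :: (int^'n) set. finite A}"
  by (rule countable_Collect_finite)

section \<open>The exponential potential and its growth at the boundary\<close>

definition potential :: "real \<Rightarrow> (int^'n) set \<Rightarrow> real" where
  "potential \<rho> A = (\<Sum>x\<in>{x\<in>A. \<rho> \<le> norm (real_vec x)}. exp (norm (real_vec x) - \<rho>))"

lemma potential_nonneg: "0 \<le> potential \<rho> A"
  by (simp add: potential_def sum_nonneg)

lemma potential_insert_le:
  assumes "finite A"
  shows "potential \<rho> (insert z A) \<le>
    potential \<rho> A + (if \<rho> \<le> norm (real_vec z) then exp (norm (real_vec z) - \<rho>) else 0)"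
proof (cases "z \<in> A")
  case True
  then show ?thesis by (simp add: insert_absorb)
next
  case False
  have "{x \<in> insert z A. \<rho> \<le> norm (real_vec x)} =
    (if \<rho> \<le> norm (real_vec z) then insert z {x \<in> A. \<rho> \<le> norm (real_vec x)} else {x \<in> A. \<rho> \<le> norm (real_vec x)})"
    by auto
  then show ?thesis using False assms by (simp add: potential_def)
qed

lemma exp_le_potential:
  assumes "finite A" "x \<in> A" "\<rho> \<le> norm (real_vec x)"
  shows "exp (norm (real_vec x) - \<rho>) \<le> potential \<rho> A"
  unfolding potential_def
  using assms by (intro member_le_sum[of x "{x \<in> A. \<rho> \<le> norm (real_vec x)}" "\<lambda>x. exp (norm (real_vec x) - \<rho>)"]) auto

text \<open>The threshold is \<open>\<rho> + 1\<close> so that the old neighbour of such a site has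
  norm at least \<open>\<rho>\<close>: it is counted by the potential and witnesses that the cluster
  is large.\<close>

definition far_boundary :: "real \<Rightarrow> (int^'n) set \<Rightarrow> (int^'n) set" where
  "far_boundary \<rho> A = {z \<in> outer_boundary A. \<rho> + 1 \<le> norm (real_vec z)}"

lemma finite_far_boundary: "finite A \<Longrightarrow> finite (far_boundary \<rho> A)"
  by (simp add: far_boundary_def finite_outer_boundary)

lemma far_boundary_neighbour:
  assumes "z \<in> far_boundary \<rho> A"
  obtains x where "x \<in> A" "neighbours z x" "\<rho> \<le> norm (real_vec x)" "norm (real_vec z) \<le> norm (real_vec x) + 1"
proof -
  obtain x where x: "x \<in> A" "neighbours z x" using assms by (auto simp: far_boundary_def outer_boundary_def)
  have "norm (real_vec z) \<le> norm (real_vec x) + 1"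
    using norm_triangle_ineq2[of "real_vec z" "real_vec x"] x(2) by (simp add: neighbours_def)
  moreover have "\<rho> + 1 \<le> norm (real_vec z)" using assms by (simp add: far_boundary_def)
  ultimately show thesis using that x by simp
qed

text \<open>Charge each far site to its old neighbours counted by the potential. One of them has
  norm smaller by at most 1, which costs a factor e; after exchanging the sums, each old point is
  charged at most once per lattice neighbour.\<close>

lemma sum_far_boundary_le:
  fixes A :: "(int^'n) set"
  assumes A: "finite A"
  shows "(\<Sum>z\<in>far_boundary \<rho> A. exp (norm (real_vec z) - \<rho>)) \<le>
    real (card {e :: int^'n. neighbours e 0}) * exp 1 * potential \<rho> A"
proof -
  let ?B = "far_boundary \<rho> A" and ?A = "{x \<in> A. \<rho> \<le> norm (real_vec x)}"
  let ?h = "\<lambda>x :: int^'n. exp 1 * exp (norm (real_vec x) - \<rho>)"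
  have "(\<Sum>z\<in>?B. exp (norm (real_vec z) - \<rho>)) \<le> (\<Sum>z\<in>?B. \<Sum>x\<in>{x \<in> ?A. neighbours z x}. ?h x)"
  proof (rule sum_mono)
    fix z assume "z \<in> ?B"
    then obtain x where x: "x \<in> A" "neighbours z x" "\<rho> \<le> norm (real_vec x)" "norm (real_vec z) \<le> norm (real_vec x) + 1"
      by (rule far_boundary_neighbour)
    have "exp (norm (real_vec z) - \<rho>) \<le> exp (1 + (norm (real_vec x) - \<rho>))" using x(4) by simp
    also have "\<dots> = ?h x" by (rule exp_add)
    also have "\<dots> \<le> (\<Sum>x\<in>{x \<in> ?A. neighbours z x}. ?h x)"
      using x A by (intro member_le_sum[of x "{x \<in> ?A. neighbours z x}" ?h]) auto
    finally show "exp (norm (real_vec z) - \<rho>) \<le> (\<Sum>x\<in>{x \<in> ?A. neighbours z x}. ?h x)" .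
  qed
  also have "\<dots> = (\<Sum>x\<in>?A. \<Sum>z\<in>{z \<in> ?B. neighbours z x}. ?h x)"
    using A by (intro sum.swap_restrict finite_far_boundary) auto
  also have "\<dots> \<le> (\<Sum>x\<in>?A. real (card {e :: int^'n. neighbours e 0}) * ?h x)"
  proof (rule sum_mono)
    fix x
    have "card {z \<in> ?B. neighbours z x} \<le> card {z. neighbours z x}"
      by (rule card_mono[OF finite_neighbours]) auto
    also have "\<dots> = card {e :: int^'n. neighbours e 0}" by (rule card_neighbours)
    finally show "(\<Sum>z\<in>{z \<in> ?B. neighbours z x}. ?h x) \<le> real (card {e :: int^'n. neighbours e 0}) * ?h x"
      by (simp add: mult_right_mono)
  qed
  also have "\<dots> = real (card {e :: int^'n. neighbours e 0}) * exp 1 * potential \<rho> A"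
    by (simp add: potential_def sum_distrib_left mult.assoc)
  finally show ?thesis .
qed

text \<open>What is kept of ballistic aggregation is the Markov step, the support of the
  distributions, and the decay of the mass of a site in the size of the cluster. \<open>D\<close> is
  the product of the number of neighbours, the loss e and the constant \<open>C\<close>.\<close>

locale growth = prob_space M for M :: "'w measure" +
  fixes F :: "nat \<Rightarrow> 'w \<Rightarrow> (int^'n) set" and y :: "nat \<Rightarrow> 'w \<Rightarrow> int^'n"
    and \<nu> :: "(int^'n) set \<Rightarrow> int^'n \<Rightarrow> real" and C D :: real
  assumes F_measurable: "n \<ge> 1 \<Longrightarrow> F n \<in> measurable M (count_space {A. finite A})"
    and y_measurable: "n \<ge> 1 \<Longrightarrow> y n \<in> measurable M (count_space UNIV)"
    and start: "\<omega> \<in> space M \<Longrightarrow> F 1 \<omega> = {0}"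
    and step: "n \<ge> 1 \<Longrightarrow> \<omega> \<in> space M \<Longrightarrow> F (n + 1) \<omega> = insert (y (n + 1) \<omega>) (F n \<omega>)"
    and transition: "n \<ge> 1 \<Longrightarrow> \<P>(\<omega> in M. \<forall>k\<in>{1..n}. F k \<omega> = A k) > 0 \<Longrightarrow>
      \<P>(\<omega> in M. y (n + 1) \<omega> = z \<bar> \<forall>k\<in>{1..n}. F k \<omega> = A k) = \<nu> (outer_boundary (A n)) z"
    and support: "z \<notin> B \<Longrightarrow> \<nu> B z = 0"
    and spread: "cluster B \<Longrightarrow> x \<in> B \<Longrightarrow> 1 \<le> norm (real_vec x :: real^'n) \<Longrightarrow>
      \<nu> (outer_boundary B) z \<le> C / norm (real_vec x :: real^'n)"
    and C_pos: "C > 0"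
    and D_eq: "D = real (card {e :: int^'n. neighbours e 0}) * exp 1 * C"
begin

lemma D_nonneg: "0 \<le> D"
  using C_pos by (simp add: D_eq)


lemma F_finite: "n \<ge> 1 \<Longrightarrow> \<omega> \<in> space M \<Longrightarrow> finite (F n \<omega>)"
  using measurable_space[OF F_measurable] by simp

lemma F_event:
  assumes "n \<ge> 1"
  shows "{\<omega> \<in> space M. F n \<omega> = B} \<in> events"
proof (cases "finite B")
  case True
  have "F n -` {B} \<inter> space M \<in> events"
    by (rule measurable_sets[OF F_measurable[OF assms]]) (use True in simp)
  moreover have "{\<omega> \<in> space M. F n \<omega> = B} = F n -` {B} \<inter> space M" by auto
  ultimately show ?thesis by (simp only:)
next
  case False
  then have "{\<omega> \<in> space M. F n \<omega> = B} = {}" using F_finite[OF assms] by auto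
  then show ?thesis by (simp only: sets.empty_sets)
qed

lemma y_event:
  assumes "n \<ge> 1"
  shows "{\<omega> \<in> space M. y n \<omega> = z} \<in> events"
proof -
  have "y n -` {z} \<inter> space M \<in> events"
    by (rule measurable_sets[OF y_measurable[OF assms]]) simp
  moreover have "{\<omega> \<in> space M. y n \<omega> = z} = y n -` {z} \<inter> space M" by auto
  ultimately show ?thesis by (simp only:)
qed

text \<open>The transition rule conditions on the full history; summing over the countably many
  histories that end in \<open>B\<close> leaves a rule for the present state.\<close>

lemma transition_state:
  assumes n: "n \<ge> 1"
  shows "emeasure M ({\<omega> \<in> space M. F n \<omega> = B} \<inter> {\<omega> \<in> space M. y (n + 1) \<omega> = z}) =
    ennreal (\<nu> (outer_boundary B) z) * emeasure M {\<omega> \<in> space M. F n \<omega> = B}"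
proof -
  \<comment> \<open>Extensional functions, so that different histories differ at some time in
    \<open>{1..n}\<close> and their events are disjoint.\<close>
  define H where "H = {h \<in> {1..n} \<rightarrow>\<^sub>E {A :: (int^'n) set. finite A}. h n = B}"
  define E where "E h = {\<omega> \<in> space M. \<forall>k\<in>{1..n}. F k \<omega> = h k}" for h
  let ?Y = "{\<omega> \<in> space M. y (n + 1) \<omega> = z}"
  have "countable ({1..n} \<rightarrow>\<^sub>E {A :: (int^'n) set. finite A})"
    by (intro countable_PiE countable_finite_lattice_sets) simp
  then have H: "countable H" unfolding H_def by (rule countable_subset[rotated]) auto
  have E: "E h \<in> events" for h
  proof -
    have "E h = {\<omega> \<in> space M. \<forall>k\<in>{1..n}. \<omega> \<in> {\<omega> \<in> space M. F k \<omega> = h k}}" by (auto simp: E_def)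
    also have "\<dots> \<in> events" by (intro sets.sets_Collect_finite_All') (use n F_event in auto)
    finally show ?thesis .
  qed
  have Y: "?Y \<in> events" by (rule y_event) simp
  have U: "{\<omega> \<in> space M. F n \<omega> = B} = (\<Union>h\<in>H. E h)"
  proof (intro equalityI subsetI)
    fix \<omega> assume w: "\<omega> \<in> {\<omega> \<in> space M. F n \<omega> = B}"
    then have "restrict (\<lambda>k. F k \<omega>) {1..n} \<in> H" using F_finite n by (auto simp: H_def)
    moreover have "\<omega> \<in> E (restrict (\<lambda>k. F k \<omega>) {1..n})" using w by (simp add: E_def)
    ultimately show "\<omega> \<in> (\<Union>h\<in>H. E h)" by blast
  qed (use n in \<open>auto simp: E_def H_def\<close>)
  have disj: "disjoint_family_on E H"
    unfolding disjoint_family_on_def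
  proof (intro ballI impI)
    fix h h' assume h: "h \<in> H" "h' \<in> H" "h \<noteq> h'"
    then obtain k where "k \<in> {1..n}" "h k \<noteq> h' k" unfolding H_def by (metis (no_types, lifting) PiE_ext mem_Collect_eq)
    then show "E h \<inter> E h' = {}" by (auto simp: E_def)
  qed
  have eq: "emeasure M (E h \<inter> ?Y) = ennreal (\<nu> (outer_boundary B) z) * emeasure M (E h)" if h: "h \<in> H" for h
  proof (cases "prob (E h) > 0")
    \<comment> \<open>A history of probability 0 is outside the transition rule, but both sides
      vanish.\<close>
    case False
    then have "prob (E h) = 0" by (simp add: zero_less_measure_iff)
    moreover have "prob (E h \<inter> ?Y) \<le> prob (E h)" using E by (intro finite_measure_mono) auto
    ultimately have "prob (E h) = 0" "prob (E h \<inter> ?Y) = 0" by (simp_all add: measure_le_0_iff)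
    then show ?thesis by (simp add: emeasure_eq_measure)
  next
    case True
    then have c: "\<P>(\<omega> in M. y (n + 1) \<omega> = z \<bar> \<forall>k\<in>{1..n}. F k \<omega> = h k) = \<nu> (outer_boundary (h n)) z"
      using transition[OF n, of h z] by (simp add: E_def)
    have joint: "{\<omega> \<in> space M. y (n + 1) \<omega> = z \<and> (\<forall>k\<in>{1..n}. F k \<omega> = h k)} = E h \<inter> ?Y"
      by (auto simp: E_def)
    have "h n = B" using h by (simp add: H_def)
    then have q: "prob (E h \<inter> ?Y) / prob (E h) = \<nu> (outer_boundary B) z"
      using c unfolding cond_prob_def joint E_def[symmetric] by simp
    then have p: "prob (E h \<inter> ?Y) = \<nu> (outer_boundary B) z * prob (E h)"
      using True by (simp add: field_simps)
    \<comment> \<open>Nonnegativity is read off from the quotient of probabilities;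
      \<open>ennreal_mult\<close> requires it.\<close>
    have "0 \<le> \<nu> (outer_boundary B) z" unfolding q[symmetric] by simp
    then show ?thesis unfolding emeasure_eq_measure p by (rule ennreal_mult) simp
  qed
  have "emeasure M ({\<omega> \<in> space M. F n \<omega> = B} \<inter> ?Y) = emeasure M (\<Union>h\<in>H. E h \<inter> ?Y)"
    unfolding U by (rule arg_cong[where f = "emeasure M"]) blast
  also have "\<dots> = (\<integral>\<^sup>+h. emeasure M (E h \<inter> ?Y) \<partial>count_space H)"
    using disj by (intro emeasure_UN_countable sets.Int E Y H) (auto simp: disjoint_family_on_def)
  also have "\<dots> = (\<integral>\<^sup>+h. ennreal (\<nu> (outer_boundary B) z) * emeasure M (E h) \<partial>count_space H)"
    by (intro nn_integral_cong eq) simp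
  also have "\<dots> = ennreal (\<nu> (outer_boundary B) z) * (\<integral>\<^sup>+h. emeasure M (E h) \<partial>count_space H)"
    by (rule nn_integral_cmult) simp
  also have "(\<integral>\<^sup>+h. emeasure M (E h) \<partial>count_space H) = emeasure M {\<omega> \<in> space M. F n \<omega> = B}"
    unfolding U by (rule emeasure_UN_countable[symmetric]) (use E H disj in auto)
  finally show ?thesis .
qed

text \<open>For each of the countably many pairs of a state \<open>B\<close> and a site off its
  boundary, the event has mass 0 by \<open>support\<close>.\<close>

lemma AE_outer_boundary:
  assumes n: "n \<ge> 1"
  shows "AE \<omega> in M. y (n + 1) \<omega> \<in> outer_boundary (F n \<omega>)"
proof -
  have "AE \<omega> in M. \<forall>B\<in>{A. finite A}. \<forall>z. z \<notin> outer_boundary B \<longrightarrow> \<not> (F n \<omega> = B \<and> y (n + 1) \<omega> = z)"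
  proof (subst AE_ball_countable[OF countable_finite_lattice_sets], intro ballI, subst AE_all_countable, intro allI)
    fix B :: "(int^'n) set" and z
    show "AE \<omega> in M. z \<notin> outer_boundary B \<longrightarrow> \<not> (F n \<omega> = B \<and> y (n + 1) \<omega> = z)"
    proof (cases "z \<in> outer_boundary B")
      case False
      let ?N = "{\<omega> \<in> space M. F n \<omega> = B} \<inter> {\<omega> \<in> space M. y (n + 1) \<omega> = z}"
      have "?N \<in> events" using F_event[OF n] y_event by (intro sets.Int) auto
      moreover have "emeasure M ?N = 0" unfolding transition_state[OF n] using support[OF False] by simp
      ultimately have "?N \<in> null_sets M" by (rule null_setsI[rotated])
      then show ?thesis by (rule AE_I') auto
    qed simp
  qed
  then show ?thesis
    by (rule AE_mp) (rule AE_I2, use F_finite[OF n] in auto)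
qed

lemma AE_cluster: "AE \<omega> in M. \<forall>n\<ge>1. cluster (F n \<omega>)"
proof -
  have "AE \<omega> in M. \<forall>n. n \<ge> 1 \<longrightarrow> y (n + 1) \<omega> \<in> outer_boundary (F n \<omega>)"
    unfolding AE_all_countable using AE_outer_boundary by auto
  then show ?thesis
  proof (rule AE_mp, intro AE_I2 impI allI)
    fix \<omega> n assume w: "\<omega> \<in> space M" and b: "\<forall>n. n \<ge> 1 \<longrightarrow> y (n + 1) \<omega> \<in> outer_boundary (F n \<omega>)"
      and n: "1 \<le> (n :: nat)"
    from n show "cluster (F n \<omega>)"
    proof (induction n rule: dec_induct)
      case base
      then show ?case using start[OF w] cluster.origin by simp
    next
      case (step n)
      then have "y (n + 1) \<omega> \<in> outer_boundary (F n \<omega>)" using b by blast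
      then have "cluster (F (n + 1) \<omega>)"
        unfolding growth.step[OF growth_axioms, OF step(1) w] by (rule cluster.grow[OF step.IH])
      then show ?case by simp
    qed
  qed
qed

lemma F_mono:
  assumes "1 \<le> m" "m \<le> n" "\<omega> \<in> space M"
  shows "F m \<omega> \<subseteq> F n \<omega>"
  using assms(2)
proof (induction n rule: dec_induct)
  case (step n)
  then show ?case using growth.step[OF growth_axioms, of n \<omega>] assms by auto
qed simp

definition expected_potential :: "real \<Rightarrow> nat \<Rightarrow> ennreal" where
  "expected_potential \<rho> n = (\<integral>\<^sup>+\<omega>. ennreal (potential \<rho> (F n \<omega>)) \<partial>M)"

lemma measurable_potential [measurable]:
  assumes "n \<ge> 1"
  shows "(\<lambda>\<omega>. ennreal (potential \<rho> (F n \<omega>))) \<in> borel_measurable M"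
  by (rule measurable_compose[OF F_measurable[OF assms]]) simp

text \<open>On the event that the cluster is \<open>B\<close>, every far site is chosen with
  conditional probability at most \<open>C / \<rho>\<close>, and the weights of far sites add up to
  a multiple of the potential of \<open>B\<close>.\<close>

lemma expected_far_growth:
  assumes n: "n \<ge> 1" and \<rho>: "\<rho> \<ge> 1"
  shows "(\<integral>\<^sup>+\<omega>. (if y (n + 1) \<omega> \<in> far_boundary \<rho> (F n \<omega>) then ennreal (exp (norm (real_vec (y (n + 1) \<omega>)) - \<rho>)) else 0) \<partial>M)
    \<le> ennreal (D / \<rho>) * expected_potential \<rho> n"
proof -
  let ?g = "\<lambda>B z. if z \<in> far_boundary \<rho> B then ennreal (exp (norm (real_vec z) - \<rho>)) else 0"
  let ?K = "real (card {e :: int^'n. neighbours e 0}) * exp 1"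
  have "(\<integral>\<^sup>+\<omega>. ?g (F n \<omega>) (y (n + 1) \<omega>) \<partial>M) \<le> (\<integral>\<^sup>+\<omega>. ennreal (D / \<rho>) * ennreal (potential \<rho> (F n \<omega>)) \<partial>M)"
  proof (rule nn_integral_le_on_atoms[OF F_measurable[OF n] countable_finite_lattice_sets])
    show "(\<lambda>\<omega>. ?g (F n \<omega>) (y (n + 1) \<omega>)) \<in> borel_measurable M"
    proof (rule measurable_compose_countable'[OF _ F_measurable[OF n] countable_finite_lattice_sets])
      fix B :: "(int^'n) set"
      show "(\<lambda>\<omega>. ?g B (y (n + 1) \<omega>)) \<in> borel_measurable M"
        by (rule measurable_compose[OF y_measurable]) simp_all
    qed
    show "(\<lambda>\<omega>. ennreal (D / \<rho>) * ennreal (potential \<rho> (F n \<omega>))) \<in> borel_measurable M"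
      using measurable_potential[OF n] by simp
    fix B :: "(int^'n) set" assume "B \<in> {A. finite A}"
    then have fin: "finite B" by simp
    let ?S = "{\<omega> \<in> space M. F n \<omega> = B}"
    let ?Y = "\<lambda>z. {\<omega> \<in> space M. y (n + 1) \<omega> = z}"
    have S: "?S \<in> events" by (rule F_event[OF n])
    have Y: "?Y z \<in> events" for z by (rule y_event) simp
    have "(\<integral>\<^sup>+\<omega>. ?g (F n \<omega>) (y (n + 1) \<omega>) * indicator ?S \<omega> \<partial>M) =
        (\<integral>\<^sup>+\<omega>. (\<Sum>z\<in>far_boundary \<rho> B. ennreal (exp (norm (real_vec z) - \<rho>)) * indicator (?S \<inter> ?Y z) \<omega>) \<partial>M)"
    proof (intro nn_integral_cong)
      fix \<omega> assume w: "\<omega> \<in> space M"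
      show "?g (F n \<omega>) (y (n + 1) \<omega>) * indicator ?S \<omega> =
        (\<Sum>z\<in>far_boundary \<rho> B. ennreal (exp (norm (real_vec z) - \<rho>)) * indicator (?S \<inter> ?Y z) \<omega>)"
      proof (cases "F n \<omega> = B")
        case True
        have "(\<Sum>z\<in>far_boundary \<rho> B. ennreal (exp (norm (real_vec z) - \<rho>)) * indicator (?S \<inter> ?Y z) \<omega>) =
          (\<Sum>z\<in>far_boundary \<rho> B. if y (n + 1) \<omega> = z then ennreal (exp (norm (real_vec z) - \<rho>)) else 0)"
          using w True by (intro sum.cong) (auto simp: indicator_def)
        then show ?thesis using w True finite_far_boundary[OF fin, of \<rho>] by simp
      qed (simp add: indicator_def)
    qed
    also have "\<dots> = (\<Sum>z\<in>far_boundary \<rho> B. ennreal (exp (norm (real_vec z) - \<rho>)) * emeasure M (?S \<inter> ?Y z))"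
      using S Y by (simp add: nn_integral_sum nn_integral_cmult sets.Int)
    also have "\<dots> \<le> (\<Sum>z\<in>far_boundary \<rho> B. ennreal (exp (norm (real_vec z) - \<rho>)) * (ennreal (C / \<rho>) * emeasure M ?S))"
    proof (intro sum_mono mult_left_mono)
      fix z assume z: "z \<in> far_boundary \<rho> B"
      show "emeasure M (?S \<inter> ?Y z) \<le> ennreal (C / \<rho>) * emeasure M ?S"
      proof (cases "cluster B")
        case True
        \<comment> \<open>The old neighbour of the far site certifies the size of the
          cluster.\<close>
        obtain x where x: "x \<in> B" "\<rho> \<le> norm (real_vec x)" using far_boundary_neighbour[OF z] by metis
        have "\<nu> (outer_boundary B) z \<le> C / norm (real_vec x)"
          using x \<rho> by (intro spread[OF True]) auto
        also have "\<dots> \<le> C / \<rho>" using x(2) \<rho> C_pos by (intro divide_left_mono mult_pos_pos) linarith+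
        finally show ?thesis unfolding transition_state[OF n] by (intro mult_right_mono ennreal_leI) auto
      next
        \<comment> \<open>The bound on the mass is available for clusters only; other states have
          probability 0.\<close>
        case False
        have "AE \<omega> in M. \<not> (F n \<omega> = B)" using AE_cluster by (rule AE_mp) (use False n in auto)
        then have "emeasure M ?S = 0" using AE_iff_measurable[OF S, of "\<lambda>\<omega>. F n \<omega> \<noteq> B"] by simp
        then show ?thesis unfolding transition_state[OF n] by simp
      qed
    qed simp
    also have "\<dots> = (\<Sum>z\<in>far_boundary \<rho> B. ennreal (exp (norm (real_vec z) - \<rho>))) * (ennreal (C / \<rho>) * emeasure M ?S)"
      by (simp only: sum_distrib_right)
    also have "\<dots> = ennreal (\<Sum>z\<in>far_boundary \<rho> B. exp (norm (real_vec z) - \<rho>)) * (ennreal (C / \<rho>) * emeasure M ?S)"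
      by (subst sum_ennreal) auto
    also have "\<dots> \<le> ennreal (?K * potential \<rho> B) * (ennreal (C / \<rho>) * emeasure M ?S)"
      by (intro mult_right_mono ennreal_leI sum_far_boundary_le fin) simp
    also have "\<dots> = ennreal (D / \<rho>) * ennreal (potential \<rho> B) * emeasure M ?S"
    proof -
      have "ennreal (?K * potential \<rho> B) * ennreal (C / \<rho>) = ennreal (?K * potential \<rho> B * (C / \<rho>))"
        using C_pos \<rho> potential_nonneg[of \<rho> B] by (intro ennreal_mult[symmetric]) auto
      also have "?K * potential \<rho> B * (C / \<rho>) = D / \<rho> * potential \<rho> B" by (simp add: D_eq)
      also have "ennreal (D / \<rho> * potential \<rho> B) = ennreal (D / \<rho>) * ennreal (potential \<rho> B)"
        using D_nonneg \<rho> potential_nonneg[of \<rho> B] by (intro ennreal_mult) auto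
      finally show ?thesis by (simp only: mult.assoc[symmetric])
    qed
    also have "\<dots> = (\<integral>\<^sup>+\<omega>. ennreal (D / \<rho>) * ennreal (potential \<rho> B) * indicator ?S \<omega> \<partial>M)"
      by (rule nn_integral_cmult_indicator[OF S, symmetric])
    also have "\<dots> = (\<integral>\<^sup>+\<omega>. ennreal (D / \<rho>) * ennreal (potential \<rho> (F n \<omega>)) * indicator ?S \<omega> \<partial>M)"
      by (intro nn_integral_cong) (auto simp: indicator_def)
    finally show "(\<integral>\<^sup>+\<omega>. ?g (F n \<omega>) (y (n + 1) \<omega>) * indicator ?S \<omega> \<partial>M) \<le>
      (\<integral>\<^sup>+\<omega>. ennreal (D / \<rho>) * ennreal (potential \<rho> (F n \<omega>)) * indicator ?S \<omega> \<partial>M)" .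
  qed
  also have "\<dots> = ennreal (D / \<rho>) * expected_potential \<rho> n"
    unfolding expected_potential_def by (rule nn_integral_cmult[OF measurable_potential[OF n]])
  finally show ?thesis .
qed

lemma expected_potential_step:
  assumes n: "n \<ge> 1" and \<rho>: "\<rho> \<ge> 1"
  shows "expected_potential \<rho> (n + 1) \<le> ennreal (1 + D / \<rho>) * expected_potential \<rho> n + ennreal (exp 1)"
proof -
  let ?g = "\<lambda>\<omega>. if y (n + 1) \<omega> \<in> far_boundary \<rho> (F n \<omega>) then ennreal (exp (norm (real_vec (y (n + 1) \<omega>)) - \<rho>)) else 0"
  have g: "?g \<in> borel_measurable M"
  proof (rule measurable_compose_countable'[OF _ F_measurable[OF n] countable_finite_lattice_sets,
      where f = "\<lambda>B \<omega>. if y (n + 1) \<omega> \<in> far_boundary \<rho> B then ennreal (exp (norm (real_vec (y (n + 1) \<omega>)) - \<rho>)) else 0"])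
    fix B :: "(int^'n) set"
    show "(\<lambda>\<omega>. if y (n + 1) \<omega> \<in> far_boundary \<rho> B then ennreal (exp (norm (real_vec (y (n + 1) \<omega>)) - \<rho>)) else 0) \<in> borel_measurable M"
      by (rule measurable_compose[OF y_measurable, where g = "\<lambda>z. if z \<in> far_boundary \<rho> B then ennreal (exp (norm (real_vec z) - \<rho>)) else 0"]) simp_all
  qed
  have "AE \<omega> in M. ennreal (potential \<rho> (F (n + 1) \<omega>)) \<le> ennreal (potential \<rho> (F n \<omega>)) + ?g \<omega> + ennreal (exp 1)"
    using AE_outer_boundary[OF n]
  proof (rule AE_mp, intro AE_I2 impI)
    fix \<omega> assume w: "\<omega> \<in> space M" and b: "y (n + 1) \<omega> \<in> outer_boundary (F n \<omega>)"
    let ?z = "y (n + 1) \<omega>" and ?B = "F n \<omega>"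
    let ?h = "if ?z \<in> far_boundary \<rho> ?B then exp (norm (real_vec ?z) - \<rho>) else 0"
    have "potential \<rho> (F (n + 1) \<omega>) \<le> potential \<rho> ?B + (if \<rho> \<le> norm (real_vec ?z) then exp (norm (real_vec ?z) - \<rho>) else 0)"
      unfolding step[OF n w] by (rule potential_insert_le[OF F_finite[OF n w]])
    \<comment> \<open>A boundary site of norm between \<open>\<rho>\<close> and
      \<open>\<rho> + 1\<close> is not far, but its weight is below e.\<close>
    also have "(if \<rho> \<le> norm (real_vec ?z) then exp (norm (real_vec ?z) - \<rho>) else 0) \<le> ?h + exp 1"
      using b by (auto simp: far_boundary_def)
    finally have "potential \<rho> (F (n + 1) \<omega>) \<le> potential \<rho> ?B + ?h + exp 1" by simp
    then have "ennreal (potential \<rho> (F (n + 1) \<omega>)) \<le> ennreal (potential \<rho> ?B + ?h + exp 1)" by (rule ennreal_leI)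
    also have "\<dots> = ennreal (potential \<rho> ?B) + ennreal ?h + ennreal (exp 1)"
      using potential_nonneg[of \<rho> ?B] by (simp add: ennreal_plus)
    also have "ennreal ?h = ?g \<omega>" by simp
    finally show "ennreal (potential \<rho> (F (n + 1) \<omega>)) \<le> ennreal (potential \<rho> ?B) + ?g \<omega> + ennreal (exp 1)" .
  qed
  then have "expected_potential \<rho> (n + 1) \<le> (\<integral>\<^sup>+\<omega>. ennreal (potential \<rho> (F n \<omega>)) + ?g \<omega> + ennreal (exp 1) \<partial>M)"
    unfolding expected_potential_def by (rule nn_integral_mono_AE)
  also have "\<dots> = expected_potential \<rho> n + (\<integral>\<^sup>+\<omega>. ?g \<omega> \<partial>M) + ennreal (exp 1)"
    using measurable_potential[OF n] g by (simp add: nn_integral_add expected_potential_def emeasure_space_1)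
  also have "\<dots> \<le> expected_potential \<rho> n + ennreal (D / \<rho>) * expected_potential \<rho> n + ennreal (exp 1)"
    by (intro add_mono expected_far_growth[OF n \<rho>]) auto
  also have "\<dots> = ennreal (1 + D / \<rho>) * expected_potential \<rho> n + ennreal (exp 1)"
    using D_nonneg \<rho> by (simp add: ennreal_plus distrib_right)
  finally show ?thesis .
qed

text \<open>Each step adds at most e, and every contribution is inflated by a factor
  \<open>1 + D / \<rho> \<le> exp (D / \<rho>)\<close> per later step.\<close>

lemma expected_potential_le:
  assumes n: "n \<ge> 1" and \<rho>: "\<rho> \<ge> 1"
  shows "expected_potential \<rho> n \<le> ennreal (exp 1 * real n * exp (D / \<rho> * real n))"
  using n
proof (induction n rule: dec_induct)
  case base
  \<comment> \<open>At time 1 the cluster is the origin, whose norm 0 is below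
    \<open>\<rho>\<close>.\<close>
  have "expected_potential \<rho> 1 = (\<integral>\<^sup>+\<omega>. 0 \<partial>M)"
    unfolding expected_potential_def
  proof (rule nn_integral_cong)
    fix \<omega> assume "\<omega> \<in> space M"
    then show "ennreal (potential \<rho> (F 1 \<omega>)) = 0"
      using \<rho> start by (simp add: potential_def)
  qed
  then show ?case by simp
next
  case (step n)
  let ?a = "D / \<rho>"
  have a: "0 \<le> ?a" using D_nonneg \<rho> by simp
  have "expected_potential \<rho> (n + 1) \<le> ennreal (1 + ?a) * expected_potential \<rho> n + ennreal (exp 1)"
    by (rule expected_potential_step[OF step(1) \<rho>])
  also have "\<dots> \<le> ennreal (1 + ?a) * ennreal (exp 1 * real n * exp (?a * real n)) + ennreal (exp 1)"
    by (intro add_mono mult_left_mono step.IH) auto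
  also have "\<dots> = ennreal ((1 + ?a) * (exp 1 * real n * exp (?a * real n)) + exp 1)"
    using a by (simp add: ennreal_mult[symmetric] ennreal_plus[symmetric] del: ennreal_plus)
  also have "\<dots> \<le> ennreal (exp 1 * real (Suc n) * exp (?a * real (Suc n)))"
  proof (rule ennreal_leI)
    have "(1 + ?a) * (exp 1 * real n * exp (?a * real n)) \<le> exp ?a * (exp 1 * real n * exp (?a * real n))"
      by (intro mult_right_mono exp_ge_add_one_self) simp
    also have "\<dots> = exp 1 * real n * exp (?a * real (Suc n))"
      by (simp add: distrib_left exp_add)
    finally have 1: "(1 + ?a) * (exp 1 * real n * exp (?a * real n)) \<le> exp 1 * real n * exp (?a * real (Suc n))" .
    have "0 \<le> ?a * real (Suc n)" using a by (rule mult_nonneg_nonneg) simp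
    then have "1 \<le> exp (?a * real (Suc n))" by simp
    then have "exp 1 * 1 \<le> exp 1 * exp (?a * real (Suc n))" by (intro mult_left_mono) auto
    moreover have "exp 1 * real (Suc n) * T = exp 1 * real n * T + exp 1 * T" for T :: real
      by (simp add: algebra_simps)
    ultimately show "(1 + ?a) * (exp 1 * real n * exp (?a * real n)) + exp 1 \<le> exp 1 * real (Suc n) * exp (?a * real (Suc n))"
      using 1 by (simp only: mult_1_right)
  qed
  finally show ?case by simp
qed

section \<open>From the expected potential to the almost sure radius bound\<close>

lemma rad_attained:
  assumes "n \<ge> 1" "\<omega> \<in> space M"
  obtains x where "x \<in> F n \<omega>" "rad (F n \<omega>) = norm (real_vec x)"
proof -
  have "F n \<omega> \<noteq> {}" using F_mono[OF order_refl assms] start[OF assms(2)] by auto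
  then have "rad (F n \<omega>) \<in> (\<lambda>x. norm (real_vec x)) ` F n \<omega>"
    unfolding rad_def by (intro Max_in finite_imageI F_finite assms) simp
  then show thesis using that by auto
qed

lemma rad_le:
  assumes "1 \<le> m" "m \<le> n" "\<omega> \<in> space M"
  shows "rad (F m \<omega>) \<le> rad (F n \<omega>)"
proof -
  obtain x where x: "x \<in> F m \<omega>" "rad (F m \<omega>) = norm (real_vec x)" by (rule rad_attained[OF assms(1,3)])
  have "norm (real_vec x) \<le> rad (F n \<omega>)"
    unfolding rad_def using x(1) F_mono[OF assms] F_finite[of n \<omega>] assms by (intro Max_ge finite_imageI) auto
  then show ?thesis by (simp add: x(2))
qed

lemma rad_event:
  assumes "n \<ge> 1"
  shows "{\<omega> \<in> space M. t \<le> rad (F n \<omega>)} \<in> events"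
proof -
  have "(\<lambda>\<omega>. rad (F n \<omega>)) \<in> borel_measurable M"
    by (rule measurable_compose[OF F_measurable[OF assms]]) simp
  then show ?thesis by measurable
qed

text \<open>Markov's inequality: a point of norm at least \<open>2 * \<rho>\<close> alone
  contributes \<open>exp \<rho>\<close> to the potential.\<close>

lemma prob_rad_ge:
  assumes n: "n \<ge> 1" and \<rho>: "\<rho> \<ge> 1"
  shows "prob {\<omega> \<in> space M. 2 * \<rho> \<le> rad (F n \<omega>)} \<le> exp 1 * real n * exp (D / \<rho> * real n - \<rho>)"
proof -
  let ?u = "\<lambda>\<omega>. ennreal (potential \<rho> (F n \<omega>))"
  have "emeasure M {\<omega> \<in> space M. 2 * \<rho> \<le> rad (F n \<omega>)} \<le> emeasure M {\<omega> \<in> space M. 1 \<le> ennreal (exp (- \<rho>)) * ?u \<omega>}"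
  proof (rule emeasure_mono)
    show "{\<omega> \<in> space M. 2 * \<rho> \<le> rad (F n \<omega>)} \<subseteq> {\<omega> \<in> space M. 1 \<le> ennreal (exp (- \<rho>)) * ?u \<omega>}"
    proof clarify
      fix \<omega> assume w: "\<omega> \<in> space M" "2 * \<rho> \<le> rad (F n \<omega>)"
      obtain x where x: "x \<in> F n \<omega>" "rad (F n \<omega>) = norm (real_vec x)" by (rule rad_attained[OF n w(1)])
      have "exp \<rho> \<le> exp (norm (real_vec x) - \<rho>)" using w(2) x(2) by simp
      also have "\<dots> \<le> potential \<rho> (F n \<omega>)"
        using w(2) x \<rho> by (intro exp_le_potential F_finite n w(1)) auto
      finally have "exp (- \<rho>) * exp \<rho> \<le> exp (- \<rho>) * potential \<rho> (F n \<omega>)" by (rule mult_left_mono) simp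
      then have "1 \<le> exp (- \<rho>) * potential \<rho> (F n \<omega>)" by (simp flip: exp_add)
      then have "ennreal 1 \<le> ennreal (exp (- \<rho>) * potential \<rho> (F n \<omega>))" by (rule ennreal_leI)
      then show "1 \<le> ennreal (exp (- \<rho>)) * ?u \<omega>" by (simp add: ennreal_mult potential_nonneg)
    qed
    show "{\<omega> \<in> space M. 1 \<le> ennreal (exp (- \<rho>)) * ?u \<omega>} \<in> events"
      using measurable_potential[OF n, of \<rho>] by measurable
  qed
  also have "\<dots> \<le> ennreal (exp (- \<rho>)) * (\<integral>\<^sup>+\<omega>. ?u \<omega> * indicator (space M) \<omega> \<partial>M)"
    using measurable_potential[OF n, of \<rho>] by (intro nn_integral_Markov_inequality) auto
  also have "(\<integral>\<^sup>+\<omega>. ?u \<omega> * indicator (space M) \<omega> \<partial>M) = expected_potential \<rho> n"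
    unfolding expected_potential_def by (intro nn_integral_cong) simp
  also have "ennreal (exp (- \<rho>)) * expected_potential \<rho> n \<le>
      ennreal (exp (- \<rho>)) * ennreal (exp 1 * real n * exp (D / \<rho> * real n))"
    by (intro mult_left_mono expected_potential_le n \<rho>) simp
  also have "\<dots> = ennreal (exp 1 * real n * exp (D / \<rho> * real n - \<rho>))"
    by (simp add: ennreal_mult[symmetric] exp_diff exp_minus field_simps)
  finally have "ennreal (prob {\<omega> \<in> space M. 2 * \<rho> \<le> rad (F n \<omega>)}) \<le> ennreal (exp 1 * real n * exp (D / \<rho> * real n - \<rho>))"
    by (simp only: emeasure_eq_measure)
  then show ?thesis by (subst (asm) ennreal_le_iff) auto
qed

lemma AE_rad_le_sqrt: "\<exists>c>0. AE \<omega> in M. \<forall>\<^sub>F n in sequentially. rad (F n \<omega>) \<le> c * real n powr (1/2)"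
proof -
  \<comment> \<open>Along the times \<open>k s\<close> and scales \<open>r s\<close>, the growth
    exponent is \<open>D * (s + 1)\<close> and the threshold exponent \<open>q * (s + 1)\<close>.
    With \<open>q \<ge> D + 1\<close> the difference is at most \<open>- (s + 1)\<close>, which
    makes the probabilities summable.\<close>
  define q where "q = nat \<lceil>D\<rceil> + 1"
  have q: "D + 1 \<le> real q" unfolding q_def by (simp add: add_mono real_nat_ceiling_ge)
  have q1: "1 \<le> q" by (simp add: q_def)
  define k where "k s = q * (s + 1)\<^sup>2" for s
  define r where "r s = real (q * (s + 1))" for s
  have k: "1 \<le> k s" for s using q1 by (simp add: k_def)
  have r: "1 \<le> r s" for s
  proof -
    have "1 \<le> q * (s + 1)" using q1 by simp
    then show ?thesis unfolding r_def by (metis of_nat_1 of_nat_le_iff)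
  qed
  define A where "A s = {\<omega> \<in> space M. 2 * r s \<le> rad (F (k s) \<omega>)}" for s
  have bound: "prob (A s) \<le> exp 1 * real q * ((real s + 1)\<^sup>2 * exp (- (real s + 1)))" for s
  proof -
    have "prob (A s) \<le> exp 1 * real (k s) * exp (D / r s * real (k s) - r s)"
      unfolding A_def by (rule prob_rad_ge[OF k r])
    also have "D / r s * real (k s) = D * (real s + 1)"
    proof -
      have "real (k s) = r s * (real s + 1)" by (simp add: r_def k_def power2_eq_square algebra_simps)
      moreover have "r s \<noteq> 0" using r[of s] by simp
      ultimately show ?thesis by simp
    qed
    also have "exp 1 * real (k s) * exp (D * (real s + 1) - r s) \<le> exp 1 * real (k s) * exp (- (real s + 1))"
    proof -
      have "(D + 1) * (real s + 1) \<le> real q * (real s + 1)" using q by (intro mult_right_mono) auto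
      then have "D * (real s + 1) - r s \<le> - (real s + 1)" by (simp add: r_def algebra_simps)
      then show ?thesis by (intro mult_left_mono) auto
    qed
    also have "\<dots> = exp 1 * real q * ((real s + 1)\<^sup>2 * exp (- (real s + 1)))"
      by (simp add: k_def algebra_simps)
    finally show ?thesis .
  qed
  have "summable (\<lambda>s. (real s + 1)\<^sup>2 * exp (- (real s + 1)))"
  proof (rule summable_comparison_test_ev)
    show "\<forall>\<^sub>F s in sequentially. norm ((real s + 1)\<^sup>2 * exp (- (real s + 1))) \<le> inverse (real s ^ 2)"
      by simp real_asymp
    show "summable (\<lambda>s. inverse (real s ^ 2))" by (rule inverse_power_summable) simp
  qed
  then have "summable (\<lambda>s. exp 1 * real q * ((real s + 1)\<^sup>2 * exp (- (real s + 1))))"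
    by (rule summable_mult)
  then have "summable (\<lambda>s. prob (A s))"
    by (rule summable_comparison_test'[where N = 0]) (use bound in simp)
  moreover have "A s \<in> events" for s unfolding A_def by (rule rad_event[OF k])
  ultimately have "AE \<omega> in M. \<forall>\<^sub>F s in sequentially. \<omega> \<in> space M - A s"
    by (intro borel_cantelli_AE1) (auto simp: emeasure_eq_measure)
  then have "AE \<omega> in M. \<forall>\<^sub>F n in sequentially. rad (F n \<omega>) \<le> (4 * real q) * real n powr (1/2)"
  proof (rule AE_mp, intro AE_I2 impI)
    fix \<omega> assume w: "\<omega> \<in> space M" and ev: "\<forall>\<^sub>F s in sequentially. \<omega> \<in> space M - A s"
    then obtain S where S: "\<And>s. s \<ge> S \<Longrightarrow> rad (F (k s) \<omega>) < 2 * r s"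
      by (auto simp: eventually_sequentially A_def not_le)
    show "\<forall>\<^sub>F n in sequentially. rad (F n \<omega>) \<le> (4 * real q) * real n powr (1/2)"
      unfolding eventually_sequentially
    proof (intro exI allI impI)
      fix n assume n: "(S + 1)\<^sup>2 \<le> n"
      \<comment> \<open>Monotonicity of the radius fills the gaps between the times
        \<open>k s\<close>: this choice gives \<open>n \<le> k s\<close> with \<open>s + 1\<close>
        still of order \<open>sqrt n\<close>.\<close>
      define s where "s = nat \<lfloor>sqrt (real n)\<rfloor>"
      have "real ((S + 1)\<^sup>2) \<le> real n" using n by (simp only: of_nat_le_iff)
      then have root: "real S + 1 \<le> sqrt (real n)" by (intro real_le_rsqrt) (simp add: add.commute)
      have s: "real s \<le> sqrt (real n)" "sqrt (real n) < real s + 1" "S \<le> s"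
      proof -
        have "real s = of_int \<lfloor>sqrt (real n)\<rfloor>" by (simp add: s_def)
        then show "real s \<le> sqrt (real n)" "sqrt (real n) < real s + 1" by linarith+
        then show "S \<le> s" using root by linarith
      qed
      have "real n = (sqrt (real n))\<^sup>2" by simp
      also have "\<dots> \<le> (real s + 1)\<^sup>2" using s(2) by (intro power_mono) auto
      finally have "real n \<le> real ((s + 1)\<^sup>2)" by (simp add: add.commute)
      then have "n \<le> (s + 1)\<^sup>2" by (simp only: of_nat_le_iff)
      also have "\<dots> \<le> k s" using q1 by (simp add: k_def)
      finally have nk: "n \<le> k s" .
      have n1: "1 \<le> n" using n one_le_power[of "S + 1" 2] by linarith
      have "rad (F n \<omega>) \<le> rad (F (k s) \<omega>)" by (rule rad_le[OF n1 nk w])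
      also have "\<dots> \<le> 2 * r s" using S[OF s(3)] by simp
      also have "\<dots> = 2 * real q * (real s + 1)" by (simp add: r_def algebra_simps)
      \<comment> \<open>Here \<open>s \<le> sqrt n\<close> and \<open>1 \<le> sqrt n\<close>, whence
        the constant \<open>4 * q\<close>.\<close>
      also have "\<dots> \<le> 2 * real q * (2 * sqrt (real n))"
        using s(1) root by (intro mult_left_mono) auto
      finally show "rad (F n \<omega>) \<le> (4 * real q) * real n powr (1/2)" by (simp add: powr_half_sqrt)
    qed
  qed
  then show ?thesis using q1 by (intro exI[of _ "4 * real q"]) auto
qed

end

theorem theorem5p2:
  fixes \<mu>\<^sub>1 :: "(real^'n::{finite,linorder}) set measure"
    and v :: "(real^'n::_) set \<Rightarrow> real^'n::_"
    and M :: "'w measure"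
    and F :: "nat \<Rightarrow> 'w \<Rightarrow> (int^'n::_) set"
  assumes "CARD('n) \<ge> 2"
    and "invariant_line_measure \<mu>\<^sub>1"
    and "line_direction v"
    and "ballistic_aggregation \<mu>\<^sub>1 v M F"
  shows "\<exists>c>0. AE \<omega> in M. \<forall>\<^sub>F n in sequentially. rad (F n \<omega>) \<le> c * real n powr (1/2)"
proof -
  obtain C where C: "C > 0" and spread: "\<And>(A :: (int^'n::_) set) x z v. cluster A \<Longrightarrow> x \<in> A \<Longrightarrow>
      1 \<le> norm (real_vec x) \<Longrightarrow> ballistic_measure \<mu>\<^sub>1 v (outer_boundary A) z \<le> C / norm (real_vec x)"
    using ballistic_measure_outer_boundary_le[OF assms(1,2)] by blast
  have agg: "incremental_aggregation (ballistic_measure \<mu>\<^sub>1 v) M F"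
    using assms(4) by (simp add: ballistic_aggregation_def)
  then interpret prob_space M by (simp add: incremental_aggregation_def)
  obtain y where Y: "(\<forall>n\<ge>1. y n \<in> measurable M (count_space UNIV)) \<and>
      (\<forall>\<omega>\<in>space M. y 1 \<omega> = 0 \<and> F 1 \<omega> = {y 1 \<omega>}) \<and>
      (\<forall>n\<ge>1. \<forall>\<omega>\<in>space M. F (n + 1) \<omega> = F n \<omega> \<union> {y (n + 1) \<omega>}) \<and>
      (\<forall>n\<ge>1. \<forall>A z. \<P>(\<omega> in M. \<forall>k\<in>{1..n}. F k \<omega> = A k) > 0 \<longrightarrow>
        \<P>(\<omega> in M. y (n + 1) \<omega> = z \<bar> \<forall>k\<in>{1..n}. F k \<omega> = A k) = ballistic_measure \<mu>\<^sub>1 v (outer_boundary (A n)) z)"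
    using agg unfolding incremental_aggregation_def by (elim conjE exE) (rule that, intro conjI)
  note y = Y[THEN conjunct1, rule_format] Y[THEN conjunct2, THEN conjunct1, rule_format]
    Y[THEN conjunct2, THEN conjunct2, THEN conjunct1, rule_format]
    Y[THEN conjunct2, THEN conjunct2, THEN conjunct2, rule_format]
  interpret growth M F y "ballistic_measure \<mu>\<^sub>1 v" C
    "real (card {e :: int^'n::_. neighbours e 0}) * exp 1 * C"
  proof
    show "F n \<in> measurable M (count_space {A. finite A})" if "n \<ge> 1" for n
      using agg that by (simp add: incremental_aggregation_def)
    show "F 1 \<omega> = {0}" if "\<omega> \<in> space M" for \<omega> using y(2)[OF that] by simp
    show "F (n + 1) \<omega> = insert (y (n + 1) \<omega>) (F n \<omega>)" if "n \<ge> 1" "\<omega> \<in> space M" for n \<omega>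
      using y(3)[OF that] by simp
  qed (fact y(1) y(4) ballistic_measure_eq_0 spread C refl)+
  show ?thesis by (rule AE_rad_le_sqrt)
qed

end
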